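(* Let $k \ge 2$ and let $\mathcal{C}=(C_1,\dots,C_k)$, $\mathcal{C}'=(C'_1,\dots,C'_k)$ be $k$-clusterings of the same data set. Then $$d(\mathcal{C},\mathcal{C}') \leq \eta_{i_1} + \max\left\{ \eta_{i_2},\ \frac{1}{2}\sum_{i=1}^k \delta_i \right\},$$ where $\delta_i = \bigl| |C_i| - |C'_i| \bigr|$, $\eta_i$ is the shared degree of the vertex $c_i$ in $CDG(\mathcal{C},\mathcal{C}')$, $i_1 = \arg\max_{i} \eta_i$, and $i_2 = \arg\max_{i\neq i_1} \eta_i$.
   Context: A $k$-clustering of a finite data set $X=\{x_1,\dots,x_n\}$ is an ordered partition $\mathcal{C}=(C_1,\dots,C_k)$ of $X$ into $k$ labeled (possibly empty) clusters, each item lying in exactly one cluster. For two $k$-clusterings $\mathcal{C}=(C_1,\dots,C_k)$, $\mathcal{C}'=(C_1',\dots,C_k')$ of $X$, the clustering-difference graph $CDG(\mathcal{C},\mathcal{C}')$ is the directed arc-labeled multigraph with vertex set $\{c_1,\dots,c_k\}$ having an edge $(c_i,c_j)$ with label $x_\ell$ if and only if $i\neq j$, $x_\ell\in C_i$ and $x_\ell\in C_j'$. Parallel edges are allowed (all labels are distinct). Directed cycles and directed paths have no repeated vertices; paths have at least one edge. The shared degree of a vertex is the minimum of its indegree and outdegree. A cyclical move transforms a $k$-clustering $\mathcal{A}$ into a $k$-clustering $\mathcal{B}$ of the same data set for which the edges of $CDG(\mathcal{A},\mathcal{B})$ form a single directed cycle; a sequential move transforms $\mathcal{A}$ into $\mathcal{B}$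 for which the edges of $CDG(\mathcal{A},\mathcal{B})$ form a single directed path. The transformation distance $d(\mathcal{C},\mathcal{C}')$ is the minimum number of cyclical and sequential moves needed to transform $\mathcal{C}$ into $\mathcal{C}'$. *)

theory Defs
  imports Complex_Main "HOL-Library.Disjoint_Sets" "Graph_Theory.Graph_Theory"
begin

text \<open>The cluster \<open>C\<^sub>i\<close> is \<open>C ! (i - 1)\<close>: clusters, and the vertices of the graph below, are
  indexed by \<open>0, \<dots>, k - 1\<close>.\<close>

definition k_clustering :: "nat \<Rightarrow> 'a set \<Rightarrow> 'a set list \<Rightarrow> bool" where
  "k_clustering k X C \<longleftrightarrow>
     length C = k \<and> (\<Union>i<k. C ! i) = X \<and> disjoint_family_on (\<lambda>i. C ! i) {..<k}"

text \<open>The edge from \<open>i\<close> to \<open>j\<close> with label \<open>x\<close> is the triple \<open>(i, x, j)\<close>.\<close>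

definition cdg :: "nat \<Rightarrow> 'a set list \<Rightarrow> 'a set list \<Rightarrow> (nat, nat \<times> 'a \<times> nat) pre_digraph" where
  "cdg k C C' =
     \<lparr> verts = {..<k},
       arcs = {(i, x, j) | i x j. i < k \<and> j < k \<and> i \<noteq> j \<and> x \<in> C ! i \<and> x \<in> C' ! j},
       tail = (\<lambda>(i, x, j). i),
       head = (\<lambda>(i, x, j). j) \<rparr>"

definition shared_degree :: "('v, 'e) pre_digraph \<Rightarrow> 'v \<Rightarrow> nat" where
  "shared_degree G v = min (in_degree G v) (out_degree G v)"

definition cyclical_move :: "nat \<Rightarrow> 'a set \<Rightarrow> 'a set list \<Rightarrow> 'a set list \<Rightarrow> bool" where
  "cyclical_move k X A B \<longleftrightarrow> k_clustering k X A \<and> k_clustering k X B \<and>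
     (\<exists>p. pre_digraph.cycle (cdg k A B) p \<and> set p = arcs (cdg k A B))"

definition sequential_move :: "nat \<Rightarrow> 'a set \<Rightarrow> 'a set list \<Rightarrow> 'a set list \<Rightarrow> bool" where
  "sequential_move k X A B \<longleftrightarrow> k_clustering k X A \<and> k_clustering k X B \<and>
     (\<exists>u p v. pre_digraph.apath (cdg k A B) u p v \<and> p \<noteq> [] \<and> set p = arcs (cdg k A B))"

definition moves :: "nat \<Rightarrow> 'a set \<Rightarrow> ('a set list \<times> 'a set list) set" where
  "moves k X = {(A, B). cyclical_move k X A B \<or> sequential_move k X A B}"

text \<open>The minimum is over a nonempty set; see \<open>moves_connected\<close> below.\<close>

definition transformation_distance :: "nat \<Rightarrow> 'a set \<Rightarrow> 'a set list \<Rightarrow> 'a set list \<Rightarrow> nat" where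
  "transformation_distance k X C C' = (LEAST n. (C, C') \<in> moves k X ^^ n)"

lemma k_clustering_unique:
  assumes "k_clustering k X C" "i < k" "j < k" "x \<in> C ! i" "x \<in> C ! j"
  shows "i = j"
  using assms unfolding k_clustering_def disjoint_family_on_def by blast

lemma k_clustering_in_iff:
  assumes "k_clustering k X C"
  shows "x \<in> X \<longleftrightarrow> (\<exists>i<k. x \<in> C ! i)"
  using assms by (auto simp: k_clustering_def)

lemma single_item_move:
  assumes A: "k_clustering k X A" and ij: "i < k" "j < k" "i \<noteq> j" and x: "x \<in> A ! i"
  defines "B \<equiv> A[i := A ! i - {x}, j := insert x (A ! j)]"
  shows "(A, B) \<in> moves k X"
proof -
  have len: "length A = k" using A by (simp add: k_clustering_def)
  have nth: "B ! m = (if m = j then insert x (A ! j) else A ! m - {x})" if "m < k" for m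
  proof (cases "m = i \<or> m = j")
    case True
    then show ?thesis using that ij len by (auto simp: B_def nth_list_update)
  next
    case False
    then have "x \<notin> A ! m" using k_clustering_unique[OF A that ij(1) _ x] by blast
    with False show ?thesis by (simp add: B_def)
  qed
  have "(\<Union>m<k. A ! m) = X" using A by (simp add: k_clustering_def)
  moreover have "(\<Union>m<k. B ! m) = (\<Union>m<k. A ! m)"
  proof
    show "(\<Union>m<k. B ! m) \<subseteq> (\<Union>m<k. A ! m)"
      using nth ij x by (auto split: if_splits)
    show "(\<Union>m<k. A ! m) \<subseteq> (\<Union>m<k. B ! m)"
    proof
      fix y assume "y \<in> (\<Union>m<k. A ! m)"
      then obtain m where m: "m < k" "y \<in> A ! m" by blast
      then have "y \<in> B ! (if y = x then j else m)" using nth ij by auto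
      then show "y \<in> (\<Union>m<k. B ! m)" using m ij by (auto split: if_splits)
    qed
  qed
  moreover have "disjoint_family_on (\<lambda>m. B ! m) {..<k}"
    unfolding disjoint_family_on_def
  proof (intro ballI impI)
    fix m n assume mn: "m \<in> {..<k}" "n \<in> {..<k}" "m \<noteq> n"
    then have "A ! m \<inter> A ! n = {}" using k_clustering_unique[OF A] by blast
    then show "B ! m \<inter> B ! n = {}" using mn nth[of m] nth[of n] by auto
  qed
  ultimately have B: "k_clustering k X B"
    using len by (simp add: k_clustering_def B_def)
  have arcs: "arcs (cdg k A B) = {(i, x, j)}"
  proof
    show "arcs (cdg k A B) \<subseteq> {(i, x, j)}"
    proof
      fix e assume "e \<in> arcs (cdg k A B)"
      then obtain a y b where e: "e = (a, y, b)" "a < k" "b < k" "a \<noteq> b" "y \<in> A ! a" "y \<in> B ! b"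
        unfolding cdg_def by auto
      then have "y \<notin> A ! b" using k_clustering_unique[OF A] by blast
      then have "b = j" "y = x" using e nth[of b] by (auto split: if_splits)
      moreover have "a = i" using k_clustering_unique[OF A _ ij(1) _ x] e \<open>y = x\<close> by blast
      ultimately show "e \<in> {(i, x, j)}" using e by simp
    qed
    show "{(i, x, j)} \<subseteq> arcs (cdg k A B)"
      using nth ij x by (simp add: cdg_def)
  qed
  have "pre_digraph.apath (cdg k A B) i [(i, x, j)] j"
    unfolding pre_digraph.apath_def pre_digraph.awalk_def
    using arcs ij by (simp add: cdg_def pre_digraph.cas.simps pre_digraph.awalk_verts.simps)
  then have "sequential_move k X A B"
    unfolding sequential_move_def using A B arcs
    by (intro conjI exI[of _ i] exI[of _ "[(i, x, j)]"] exI[of _ j]) auto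
  then show ?thesis by (simp add: moves_def)
qed

lemma moves_connected:
  assumes "finite X" "k_clustering k X C" "k_clustering k X C'"
  shows "\<exists>n. (C, C') \<in> moves k X ^^ n"
  using assms(2)
proof (induction "card {x \<in> X. \<exists>i<k. x \<in> C ! i \<and> x \<notin> C' ! i}" arbitrary: C rule: less_induct)
  case less
  show ?case
  proof (cases "{x \<in> X. \<exists>i<k. x \<in> C ! i \<and> x \<notin> C' ! i} = {}")
    case True
    have sub: "y \<in> C' ! m" if "m < k" "y \<in> C ! m" for m y
    proof -
      have "y \<in> X" using k_clustering_in_iff[OF less.prems] that by blast
      then show ?thesis using True that by blast
    qed
    have "C ! i = C' ! i" if "i < k" for i
    proof
      show "C ! i \<subseteq> C' ! i"
        using sub that by blast
      show "C' ! i \<subseteq> C ! i"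
      proof
        fix x assume x: "x \<in> C' ! i"
        then have "x \<in> X" using k_clustering_in_iff[OF assms(3), of x] that by blast
        then obtain m where m: "m < k" "x \<in> C ! m"
          using k_clustering_in_iff[OF less.prems, of x] by blast
        then have "x \<in> C' ! m" by (rule sub)
        then show "x \<in> C ! i"
          using k_clustering_unique[OF assms(3) m(1) that _ x] m by simp
      qed
    qed
    moreover have "length C = k" "length C' = k"
      using less.prems assms(3) by (simp_all add: k_clustering_def)
    ultimately have "C = C'" by (simp add: list_eq_iff_nth_eq)
    then have "(C, C') \<in> moves k X ^^ 0" by simp
    then show ?thesis by blast
  next
    case False
    then obtain x i where x: "x \<in> X" "i < k" "x \<in> C ! i" "x \<notin> C' ! i" by blast
    then obtain j where j: "j < k" "x \<in> C' ! j"
      using k_clustering_in_iff[OF assms(3), of x] by blast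
    have ij: "i \<noteq> j" using x j by blast
    define B where "B = C[i := C ! i - {x}, j := insert x (C ! j)]"
    have move: "(C, B) \<in> moves k X"
      unfolding B_def by (rule single_item_move[OF less.prems x(2) j(1) ij x(3)])
    then have B: "k_clustering k X B"
      unfolding moves_def cyclical_move_def sequential_move_def by blast
    have len: "length C = k" using less.prems by (simp add: k_clustering_def)
    have nth: "B ! m = (if m = j then insert x (C ! j) else C ! m - {x})" if "m < k" for m
    proof (cases "m = i \<or> m = j")
      case True
      then show ?thesis using that ij j x len by (auto simp: B_def nth_list_update)
    next
      case False
      then have "x \<notin> C ! m" using k_clustering_unique[OF less.prems that x(2) _ x(3)] by blast
      with False show ?thesis by (simp add: B_def)
    qed
    have B_C: "y \<in> C ! m \<and> y \<noteq> x" if "m < k" "y \<in> B ! m" "y \<notin> C' ! m" for m y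
    proof -
      have "m \<noteq> j \<or> y \<noteq> x" using that(3) j(2) by blast
      then show ?thesis using nth[OF that(1)] that(2) by (auto split: if_splits)
    qed
    let ?D = "\<lambda>A. {y \<in> X. \<exists>m<k. y \<in> A ! m \<and> y \<notin> C' ! m}"
    have "?D B \<subseteq> ?D C - {x}"
    proof
      fix y assume "y \<in> ?D B"
      then obtain m where m: "y \<in> X" "m < k" "y \<in> B ! m" "y \<notin> C' ! m" by fast
      then have "y \<in> C ! m" "y \<noteq> x" using B_C by simp_all
      with m show "y \<in> ?D C - {x}" by fast
    qed
    then have "card (?D B) \<le> card (?D C - {x})"
      by (rule card_mono[rotated]) (simp add: assms(1))
    also have "x \<in> ?D C" using x by fast
    then have "card (?D C - {x}) < card (?D C)"
      by (rule card_Diff1_less[rotated]) (simp add: assms(1))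
    finally have "card (?D B) < card (?D C)" .
    from less.hyps[OF this B] obtain n where "(B, C') \<in> moves k X ^^ n" by blast
    with move have "(C, C') \<in> moves k X ^^ Suc n" by (rule relpow_Suc_I2)
    then show ?thesis by blast
  qed
qed

end

theory Submission
  imports Defs
begin

text \<open>The edges of the difference graph split into cycles and \<open>T = 1/2 \<Sum>\<^sub>i \<delta>\<^sub>i\<close> paths. While
  \<open>T > \<eta>\<^bsub>i\<^sub>2\<^esub>\<close> and \<open>T > \<eta>\<^bsub>i\<^sub>1\<^esub>\<close>, apply a path; while \<open>\<eta>\<^bsub>i\<^sub>1\<^esub>\<close> exceeds both \<open>\<eta>\<^bsub>i\<^sub>2\<^esub>\<close> and \<open>T\<close>, apply a
  cycle or path through \<open>i\<^sub>1\<close>. Once all shared degrees and \<open>T\<close> are bounded by the same \<open>m\<close>, a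
  matching argument on a bipartite multigraph gives a set of edges that meets every vertex of
  shared degree \<open>m\<close> and consists of vertex-disjoint cycles and at most one path (exactly one if
  \<open>T = m\<close>), which may touch the cycles only in its end points. Such a set, however many cycles it
  has, is realised by two moves: the first move runs through all cycles in one go, and the second
  one corrects the items that moved on to the next cycle instead of returning. This lowers \<open>m\<close>
  by one at the cost of two moves.\<close>

text \<open>A clustering is treated as an assignment \<open>f\<close> of clusters to items; the
  edges of the difference graph are the items where \<open>f\<close> and the target \<open>h\<close>
  differ. Carrying out a set \<open>M\<close> of edges yields \<open>override_on f h M\<close>, so
  progress is plain set difference of edges. The number of paths is half the sum of the \<delta>
  values because items that stay put cancel: each \<delta> is the absolute difference of outdegree
  and indegree, and the positive and the negative differences have equal totals. Removing a path
  must not raise a shared degree; hence it has to run from a vertex with more outgoing edges to one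
  with more incoming edges. The bound is a sum of two quantities, and a slice lowers both of them by
  one; this is what pays for two moves. A slice is controlled only through shared degrees of at most
  one, so an end of its path may have two outgoing or two incoming edges, one of them on a cycle.
  The case distinctions in the realisation of a slice come from this contact.\<close>

subsection \<open>Systems of distinct representatives\<close>

text \<open>Rado's argument: while some \<open>A i\<close> has two elements, one of them can be deleted
  without violating the marriage condition, by submodularity of \<open>J \<mapsto> card (\<Union>(A ` J))\<close>.\<close>

lemma hall:
  fixes A :: "'i \<Rightarrow> 'b set"
  assumes "finite I" and "\<And>i. i \<in> I \<Longrightarrow> finite (A i)"
    and "\<And>J. J \<subseteq> I \<Longrightarrow> card J \<le> card (\<Union>(A ` J))"
  shows "\<exists>\<sigma>. inj_on \<sigma> I \<and> (\<forall>i\<in>I. \<sigma> i \<in> A i)"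
  using assms(2,3)
proof (induction "\<Sum>i\<in>I. card (A i)" arbitrary: A rule: less_induct)
  case less
  note fin = less.prems(1) and hall = less.prems(2)
  show ?case
  proof (cases "\<exists>i\<in>I. \<exists>x\<in>A i. \<exists>y\<in>A i. x \<noteq> y")
    case False
    have ne: "A i \<noteq> {}" if "i \<in> I" for i
      using hall[of "{i}"] that by auto
    define \<sigma> where "\<sigma> i = (SOME x. x \<in> A i)" for i
    have \<sigma>: "\<sigma> i \<in> A i" if "i \<in> I" for i
      using ne[OF that] unfolding \<sigma>_def by (simp add: some_in_eq)
    have sing: "A i = {\<sigma> i}" if "i \<in> I" for i
      using False \<sigma>[OF that] that by blast
    have "inj_on \<sigma> I"
    proof (rule inj_onI, rule ccontr)
      fix i j assume ij: "i \<in> I" "j \<in> I" "\<sigma> i = \<sigma> j" "i \<noteq> j"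
      then have "card {i, j} \<le> card {\<sigma> i}"
        using hall[of "{i, j}"] sing[of i] sing[of j] by simp
      then show False using ij by simp
    qed
    then show ?thesis using \<sigma> by blast
  next
    case True
    then obtain i x y where i: "i \<in> I" and xy: "x \<in> A i" "y \<in> A i" "x \<noteq> y" by blast
    \<comment> \<open>Without representatives, the induction hypothesis says that deleting
      \<open>z\<close> violates the marriage condition, and this can only happen at a set containing
      \<open>i\<close>; \<open>J\<close> is that set without \<open>i\<close>.\<close>
    have smaller: "\<exists>J\<subseteq>I - {i}. card (\<Union>(A ` J) \<union> (A i - {z})) \<le> card J"
      if z: "z \<in> A i" and no: "\<nexists>\<sigma>. inj_on \<sigma> I \<and> (\<forall>i\<in>I. \<sigma> i \<in> A i)" for z
    proof (rule ccontr)
      assume neg: "\<not> ?thesis"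
      let ?B = "A(i := A i - {z})"
      have less_B: "(\<Sum>j\<in>I. card (?B j)) < (\<Sum>j\<in>I. card (A j))"
      proof (rule sum_strict_mono_ex1)
        show "\<forall>j\<in>I. card (?B j) \<le> card (A j)"
          using fin by (simp add: card_Diff1_le)
        have "card (A i - {z}) < card (A i)"
          using fin[OF i] z by (rule card_Diff1_less)
        then show "\<exists>j\<in>I. card (?B j) < card (A j)" using i by auto
      qed (rule assms(1))
      have hallB: "card J \<le> card (\<Union>(?B ` J))" if J: "J \<subseteq> I" for J
      proof (cases "i \<in> J")
        case False
        then have "?B ` J = A ` J" by auto
        then show ?thesis using hall[OF J] by simp
      next
        case True
        have "J - {i} \<subseteq> I - {i}" using J by blast
        then have "card (J - {i}) < card (\<Union>(A ` (J - {i})) \<union> (A i - {z}))"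
          using neg by (meson not_le)
        moreover have "\<Union>(?B ` J) = \<Union>(A ` (J - {i})) \<union> (A i - {z})"
          using True by auto
        moreover have "card J = Suc (card (J - {i}))"
          using True J assms(1) by (metis card.remove finite_subset)
        ultimately show ?thesis by simp
      qed
      have finB: "finite (?B j)" if "j \<in> I" for j using fin that i by simp
      have "\<exists>\<sigma>. inj_on \<sigma> I \<and> (\<forall>j\<in>I. \<sigma> j \<in> ?B j)"
        by (rule less.hyps[OF less_B finB hallB])
      then obtain \<sigma> where "inj_on \<sigma> I" "\<forall>j\<in>I. \<sigma> j \<in> ?B j" by blast
      moreover have "?B j \<subseteq> A j" for j by auto
      ultimately show False using no by blast
    qed
    show ?thesis
    proof (rule ccontr)
      assume no: "\<not> ?thesis"
      obtain P Q where P: "P \<subseteq> I - {i}" "card (\<Union>(A ` P) \<union> (A i - {x})) \<le> card P"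
        and Q: "Q \<subseteq> I - {i}" "card (\<Union>(A ` Q) \<union> (A i - {y})) \<le> card Q"
        using smaller[OF xy(1) no] smaller[OF xy(2) no] by blast
      let ?U = "\<Union>(A ` P) \<union> (A i - {x})" and ?W = "\<Union>(A ` Q) \<union> (A i - {y})"
      have finPQ: "finite P" "finite Q" using P Q assms(1) by (meson finite_Diff finite_subset)+
      have finUW: "finite ?U" "finite ?W" using finPQ P(1) Q(1) fin i by auto
      \<comment> \<open>As \<open>x\<close> and \<open>y\<close> differ, the union regains all of
        \<open>A i\<close>, so the marriage condition applies to
        \<open>insert i (P \<union> Q)\<close>. The extra element \<open>i\<close> is one too many
        for \<open>card P + card Q\<close>.\<close>
      have "?U \<union> ?W = \<Union>(A ` insert i (P \<union> Q))" using xy by auto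
      moreover have "i \<notin> P \<union> Q" "insert i (P \<union> Q) \<subseteq> I" using P(1) Q(1) i by auto
      ultimately have un: "Suc (card (P \<union> Q)) \<le> card (?U \<union> ?W)"
        using hall[of "insert i (P \<union> Q)"] finPQ by simp
      have "\<Union>(A ` (P \<inter> Q)) \<subseteq> ?U \<inter> ?W" by auto
      then have int: "card (P \<inter> Q) \<le> card (?U \<inter> ?W)"
        using hall[of "P \<inter> Q"] P(1) finUW by (meson Diff_subset card_mono dual_order.trans finite_Int inf.coboundedI1)
      have "card P + card Q = card (P \<union> Q) + card (P \<inter> Q)"
        using finPQ by (rule card_Un_Int)
      moreover have "card ?U + card ?W = card (?U \<union> ?W) + card (?U \<inter> ?W)"
        using finUW by (rule card_Un_Int)
      ultimately show False using un int P(2) Q(2) by linarith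
    qed
  qed
qed

subsection \<open>Degrees and matchings\<close>

definition deg :: "('a \<Rightarrow> 'v) \<Rightarrow> 'a set \<Rightarrow> 'v \<Rightarrow> nat" where
  "deg f E v = card {x \<in> E. f x = v}"

lemma sum_deg:
  assumes "finite E" "finite S" "f ` E \<subseteq> S"
  shows "(\<Sum>v\<in>S. deg f E v) = card E"
  using sum.group[OF assms, of "\<lambda>_. 1 :: nat"] by (simp add: deg_def)

lemma deg_Diff:
  assumes "finite E" "M \<subseteq> E"
  shows "deg f (E - M) v = deg f E v - deg f M v"
proof -
  have "{x \<in> E - M. f x = v} = {x \<in> E. f x = v} - {x \<in> M. f x = v}" by blast
  then show ?thesis unfolding deg_def
    using assms by (simp add: card_Diff_subset finite_subset Collect_mono_iff subset_iff)
qed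

lemma deg_mono: "finite E \<Longrightarrow> M \<subseteq> E \<Longrightarrow> deg f M v \<le> deg f E v"
  unfolding deg_def by (rule card_mono) auto

lemma deg_pos_iff: "finite E \<Longrightarrow> 0 < deg f E v \<longleftrightarrow> v \<in> f ` E"
  unfolding deg_def by (auto simp: card_gt_0_iff)

lemma deg_inj_on:
  assumes "finite M" "inj_on f M"
  shows "deg f M v = (if v \<in> f ` M then 1 else 0)"
proof (cases "v \<in> f ` M")
  case True
  then obtain x where "x \<in> M" "f x = v" by blast
  then have "{y \<in> M. f y = v} = {x}" using assms(2) by (auto dest: inj_onD)
  then show ?thesis using True by (simp add: deg_def)
next
  case False
  then have "{y \<in> M. f y = v} = {}" by blast
  then show ?thesis using False unfolding deg_def by (simp only: card.empty if_False)
qed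

lemma inj_on_if_deg_le_1:
  assumes "finite M" "\<And>v. deg f M v \<le> 1"
  shows "inj_on f M"
proof (rule inj_onI)
  fix x y assume "x \<in> M" "y \<in> M" "f x = f y"
  then show "x = y" using assms(2)[of "f x"] assms(1)
    by (auto simp: deg_def card_le_Suc0_iff_eq)
qed

text \<open>A regular bipartite multigraph has a perfect matching, here a permutation \<sigma> of
  the vertices. Vertices where only a padding loop realises \<sigma> are discarded: they are fixed
  points, so tails and heads of the rest still agree, and their degree is below \<open>m\<close>, so
  no vertex of degree \<open>m\<close> is lost.\<close>

lemma matching_covers_max_degree:
  assumes fin: "finite E" and eq: "\<And>n. deg t E n = deg h E n"
    and le: "\<And>n. deg t E n \<le> m" and m: "0 < m"
  shows "\<exists>M\<subseteq>E. inj_on t M \<and> inj_on h M \<and> t ` M = h ` M \<and> (\<forall>n. deg t E n = m \<longrightarrow> n \<in> t ` M)"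
proof -
  define W where "W = t ` E"
  have img: "h ` E = W"
    using deg_pos_iff[OF fin] eq unfolding W_def by (metis (no_types, lifting) subsetI subset_antisym)
  have finW: "finite W" using fin by (simp add: W_def)
  \<comment> \<open>Loops pad \<open>E\<close> to an \<open>m\<close>-regular multigraph; \<open>N\<close> is its adjacency matrix.\<close>
  define F where "F n n' = {x \<in> E. t x = n \<and> h x = n'}" for n n'
  define N where "N n n' = card (F n n') + (if n = n' then m - deg t E n else 0)" for n n'
  have row: "(\<Sum>n'\<in>W. N n n') = m" if "n \<in> W" for n
  proof -
    have "(\<Sum>n'\<in>W. card (F n n')) = deg t E n"
      using sum_deg[of "{x \<in> E. t x = n}" W h] fin finW img
      by (force simp: deg_def F_def conj_assoc)
    then show ?thesis using that le[of n] finW by (simp add: N_def sum.distrib)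
  qed
  have col: "(\<Sum>n\<in>W. N n n') = m" if "n' \<in> W" for n'
  proof -
    have "{x \<in> E. h x = n' \<and> t x = n} = F n n'" for n by (auto simp: F_def)
    then have "(\<Sum>n\<in>W. card (F n n')) = deg h E n'"
      using sum_deg[of "{x \<in> E. h x = n'}" W t] fin finW W_def
      by (force simp: deg_def conj_assoc)
    then show ?thesis using that le[of n'] finW eq[of n'] by (simp add: N_def sum.distrib)
  qed
  define A where "A n = {n' \<in> W. 0 < N n n'}" for n
  have "card J \<le> card (\<Union>(A ` J))" if J: "J \<subseteq> W" for J
  proof -
    let ?U = "\<Union>(A ` J)"
    have U: "?U \<subseteq> W" by (auto simp: A_def)
    have finJ: "finite J" using J finW by (rule finite_subset)
    \<comment> \<open>In the padded graph, the \<open>m * card J\<close> edges leaving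
      \<open>J\<close> all arrive in \<open>?U\<close>, which receives only
      \<open>m * card ?U\<close>.\<close>
    have "m * card J = (\<Sum>n\<in>J. \<Sum>n'\<in>W. N n n')"
      using row J by (simp add: subset_iff)
    also have "\<dots> = (\<Sum>n\<in>J. \<Sum>n'\<in>?U. N n n')"
      by (intro sum.cong refl sum.mono_neutral_right finW U) (auto simp: A_def)
    also have "\<dots> \<le> (\<Sum>n\<in>W. \<Sum>n'\<in>?U. N n n')"
      by (intro sum_mono2 finW J) auto
    also have "\<dots> = (\<Sum>n'\<in>?U. \<Sum>n\<in>W. N n n')" by (rule sum.swap)
    also have "\<dots> = (\<Sum>n'\<in>?U. m)" using col U by (intro sum.cong) auto
    finally show ?thesis using m by simp
  qed
  moreover have "finite (A n)" for n using finW by (simp add: A_def)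
  ultimately have "\<exists>\<sigma>. inj_on \<sigma> W \<and> (\<forall>n\<in>W. \<sigma> n \<in> A n)"
    by (intro hall[OF finW])
  then obtain \<sigma> where inj: "inj_on \<sigma> W" and \<sigma>: "\<And>n. n \<in> W \<Longrightarrow> \<sigma> n \<in> A n"
    by blast
  have \<sigma>W: "\<sigma> ` W = W"
    using inj \<sigma> finW by (intro endo_inj_surj) (auto simp: A_def)
  define W' where "W' = {n \<in> W. F n (\<sigma> n) \<noteq> {}}"
  define \<iota> where "\<iota> n = (SOME x. x \<in> F n (\<sigma> n))" for n
  have \<iota>: "\<iota> n \<in> E" "t (\<iota> n) = n" "h (\<iota> n) = \<sigma> n" if "n \<in> W'" for n
  proof -
    have "\<iota> n \<in> F n (\<sigma> n)" using that unfolding W'_def \<iota>_def by (simp add: some_in_eq)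
    then show "\<iota> n \<in> E" "t (\<iota> n) = n" "h (\<iota> n) = \<sigma> n" by (auto simp: F_def)
  qed
  have fixed: "\<sigma> n = n" "deg t E n < m" if "n \<in> W" "n \<notin> W'" for n
    using \<sigma>[OF that(1)] that by (auto simp: W'_def A_def N_def split: if_splits)
  have "\<sigma> ` W' = W'"
  proof -
    have "\<sigma> ` (W - W') = W - W'" using fixed by force
    moreover have "\<sigma> ` W' = \<sigma> ` W - \<sigma> ` (W - W')"
      using inj_on_image_set_diff[OF inj, of W "W - W'"] by (simp add: W'_def double_diff)
    ultimately show ?thesis using \<sigma>W by (auto simp: W'_def)
  qed
  moreover have "t ` \<iota> ` W' = W'" "h ` \<iota> ` W' = \<sigma> ` W'" using \<iota> by (force simp: image_image)+
  moreover have "inj_on t (\<iota> ` W')" using \<iota> by (auto intro!: inj_onI)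
  moreover have "inj_on h (\<iota> ` W')"
  proof (rule inj_onI)
    fix x y assume "x \<in> \<iota> ` W'" "y \<in> \<iota> ` W'" "h x = h y"
    then obtain a b where "a \<in> W'" "b \<in> W'" "x = \<iota> a" "y = \<iota> b" "\<sigma> a = \<sigma> b" using \<iota> by auto
    then show "x = y" using inj by (auto simp: W'_def dest: inj_onD)
  qed
  moreover have "n \<in> W'" if "deg t E n = m" for n
    using fixed(2)[of n] that m deg_pos_iff[OF fin, of t n] by (auto simp: W_def)
  moreover have "\<iota> ` W' \<subseteq> E" using \<iota> by auto
  ultimately show ?thesis by (intro exI[of _ "\<iota> ` W'"]) auto
qed

subsection \<open>Walks\<close>

text \<open>An item \<open>x\<close> is an arc from \<open>f x\<close> to \<open>g x\<close>.\<close>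

fun chain :: "('a \<Rightarrow> 'v) \<Rightarrow> ('a \<Rightarrow> 'v) \<Rightarrow> 'v \<Rightarrow> 'a list \<Rightarrow> 'v \<Rightarrow> bool" where
  "chain f g u [] v \<longleftrightarrow> u = v"
| "chain f g u (x # xs) v \<longleftrightarrow> f x = u \<and> chain f g (g x) xs v"

text \<open>A directed path if \<open>u \<noteq> v\<close>, a directed cycle if \<open>u = v\<close>.\<close>

definition simple_walk :: "('a \<Rightarrow> 'v) \<Rightarrow> ('a \<Rightarrow> 'v) \<Rightarrow> 'v \<Rightarrow> 'a list \<Rightarrow> 'v \<Rightarrow> bool" where
  "simple_walk f g u xs v \<longleftrightarrow>
     xs \<noteq> [] \<and> chain f g u xs v \<and> distinct (map f xs) \<and> v \<notin> set (tl (map f xs))"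

lemma chain_append:
  "chain f g u (xs @ ys) v \<longleftrightarrow> (\<exists>w. chain f g u xs w \<and> chain f g w ys v)"
  by (induction xs arbitrary: u) auto

lemma chain_cong:
  assumes "\<And>x. x \<in> set xs \<Longrightarrow> f x = f' x" "\<And>x. x \<in> set xs \<Longrightarrow> g x = g' x"
  shows "chain f g u xs v \<longleftrightarrow> chain f' g' u xs v"
  using assms by (induction xs arbitrary: u) auto

lemma chain_hd: "chain f g u xs v \<Longrightarrow> xs \<noteq> [] \<Longrightarrow> f (hd xs) = u"
  by (cases xs) auto

lemma chain_last: "chain f g u xs v \<Longrightarrow> xs \<noteq> [] \<Longrightarrow> g (last xs) = v"
  by (induction xs arbitrary: u) (auto split: if_splits)

lemma chain_vertices: "chain f g u xs v \<Longrightarrow> insert v (f ` set xs) = insert u (g ` set xs)"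
  by (induction xs arbitrary: u) auto

lemma chain_deg:
  assumes "chain f g u xs v" "distinct xs"
  shows "deg f (set xs) j + of_bool (j = v) = deg g (set xs) j + of_bool (j = u)"
  using assms
proof (induction xs arbitrary: u)
  case (Cons x xs)
  have ins: "deg p (insert x (set xs)) j = of_bool (p x = j) + deg p (set xs) j" for p :: "'a \<Rightarrow> 'b"
  proof -
    have "{y \<in> insert x (set xs). p y = j} =
        (if p x = j then insert x {y \<in> set xs. p y = j} else {y \<in> set xs. p y = j})" by auto
    then show ?thesis using Cons.prems(2) by (auto simp: deg_def)
  qed
  show ?case using Cons.IH[of "g x"] Cons.prems by (auto simp: ins)
qed (auto simp: deg_def)

definition arc_rel :: "('a \<Rightarrow> 'v) \<Rightarrow> ('a \<Rightarrow> 'v) \<Rightarrow> 'a set \<Rightarrow> 'v rel" where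
  "arc_rel f h E = (\<lambda>x. (f x, h x)) ` E"

lemma arc_rel_converse: "arc_rel h f E = (arc_rel f h E)\<inverse>"
  by (auto simp: arc_rel_def)

lemma reachable_chain:
  assumes "(u, v) \<in> (arc_rel f h E)\<^sup>*"
  shows "\<exists>xs. chain f h u xs v \<and> set xs \<subseteq> E \<and> distinct (map f xs) \<and> v \<notin> f ` set xs"
  using assms
proof (induction rule: converse_rtrancl_induct)
  case base
  show ?case by (intro exI[of _ "[]"]) simp
next
  case (step u w)
  then obtain x xs where x: "x \<in> E" "f x = u" "h x = w"
    and xs: "chain f h w xs v" "set xs \<subseteq> E" "distinct (map f xs)" "v \<notin> f ` set xs"
    by (auto simp: arc_rel_def)
  consider "u = v" | "u \<in> f ` set xs" | "u \<noteq> v" "u \<notin> f ` set xs" by blast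
  then show ?case
  proof cases
    case 1
    then show ?thesis by (intro exI[of _ "[]"]) simp
  next
    \<comment> \<open>A second visit to \<open>u\<close> is avoided by keeping only the part of the
      walk that starts at its visit to \<open>u\<close>.\<close>
    case 2
    then obtain y where "y \<in> set xs" "f y = u" by auto
    then obtain as bs where "xs = as @ y # bs" by (meson split_list)
    with xs \<open>f y = u\<close> show ?thesis
      by (intro exI[of _ "y # bs"]) (auto simp: chain_append)
  next
    case 3
    with x xs show ?thesis by (intro exI[of _ "x # xs"]) auto
  qed
qed

lemma chain_reachable:
  assumes "chain f h u xs v" "set xs \<subseteq> E" "w \<in> insert v (f ` set xs)"
  shows "(u, w) \<in> (arc_rel f h E)\<^sup>* \<and> (w, v) \<in> (arc_rel f h E)\<^sup>*"
  using assms
proof (induction xs arbitrary: u w)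
  case (Cons x xs)
  then have "(u, h x) \<in> arc_rel f h E" by (auto simp: arc_rel_def)
  moreover have "(h x, w) \<in> (arc_rel f h E)\<^sup>* \<and> (w, v) \<in> (arc_rel f h E)\<^sup>*" if "w \<noteq> u"
    using Cons that by auto
  moreover have "(h x, v) \<in> (arc_rel f h E)\<^sup>*" using Cons.IH[of "h x" v] Cons.prems by auto
  ultimately show ?case by (cases "w = u") (auto intro: converse_rtrancl_into_rtrancl)
qed simp

lemma simple_cycle:
  assumes "x \<in> E" "f x \<noteq> h x" "(h x, f x) \<in> (arc_rel f h E)\<^sup>*"
  obtains xs where "chain f h (f x) (x # xs) (f x)" "set (x # xs) \<subseteq> E" "distinct (map f (x # xs))"
    "xs \<noteq> []"
proof -
  obtain xs where "chain f h (h x) xs (f x)" "set xs \<subseteq> E" "distinct (map f xs)" "f x \<notin> f ` set xs"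
    using reachable_chain[OF assms(3)] by blast
  moreover from this have "xs \<noteq> []" using assms(2) by auto
  ultimately show ?thesis using assms(1) by (intro that) auto
qed

text \<open>The set of vertices reachable from \<open>i\<close> is closed under outgoing arcs, so
  within the arcs that start there outdegrees and indegrees have the same sum. If \<open>i\<close>
  gets back less than it sends out, some other reachable vertex receives more than it sends. This
  one count yields draining paths, walks through a given vertex and the cycles of a
  permutation.\<close>

lemma reachable_deficit:
  assumes fin: "finite E"
    and less: "card {x \<in> E. h x = i \<and> (i, f x) \<in> (arc_rel f h E)\<^sup>*} < deg f E i"
  shows "\<exists>v. (i, v) \<in> (arc_rel f h E)\<^sup>* \<and> v \<noteq> i \<and> deg f E v < deg h E v"
proof (rule ccontr)
  assume neg: "\<not> ?thesis"
  define S where "S = {v. (i, v) \<in> (arc_rel f h E)\<^sup>*}"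
  define E' where "E' = {x \<in> E. f x \<in> S}"
  have no: "deg h E v \<le> deg f E v" if "v \<in> S" "v \<noteq> i" for v
    using that neg by (auto simp: S_def not_less)
  have E': "finite E'" "E' \<subseteq> E" using fin by (auto simp: E'_def)
  have "S \<subseteq> insert i (h ` E)"
  proof
    fix v assume "v \<in> S"
    then show "v \<in> insert i (h ` E)"
      unfolding S_def by (auto elim: rtranclE simp: arc_rel_def)
  qed
  then have finS: "finite S" using fin by (simp add: finite_subset)
  have hS: "h x \<in> S" if "x \<in> E'" for x
    using that unfolding E'_def S_def by (auto simp: arc_rel_def intro: rtrancl_into_rtrancl)
  have "deg h E' i < deg f E i"
    using less by (simp add: deg_def E'_def S_def conj_ac)
  moreover have "deg h E' v \<le> deg f E v" if "v \<in> S" "v \<noteq> i" for v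
    using no[OF that] deg_mono[OF fin E'(2), of h v] by linarith
  moreover have "i \<in> S" by (simp add: S_def)
  ultimately have "(\<Sum>v\<in>S. deg h E' v) < (\<Sum>v\<in>S. deg f E v)"
    by (intro sum_strict_mono_ex1 finS) (auto intro: less_imp_le)
  moreover have "deg f E v = deg f E' v" if "v \<in> S" for v
    using that unfolding deg_def E'_def by (intro arg_cong[of _ _ card]) auto
  moreover have "(\<Sum>v\<in>S. deg h E' v) = card E'" "(\<Sum>v\<in>S. deg f E' v) = card E'"
    using sum_deg[OF E'(1) finS, of h] sum_deg[OF E'(1) finS, of f] hS by (auto simp: E'_def)
  ultimately show False by simp
qed

subsection \<open>Removing walks and slices\<close>

definition shared :: "('a \<Rightarrow> 'v) \<Rightarrow> ('a \<Rightarrow> 'v) \<Rightarrow> 'a set \<Rightarrow> 'v \<Rightarrow> nat" where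
  "shared f h E j = min (deg f E j) (deg h E j)"

text \<open>Subtraction of naturals keeps only the vertices with more outgoing than incoming arcs,
  so this counts the paths in a decomposition into cycles and paths.\<close>

definition surplus :: "'v set \<Rightarrow> ('a \<Rightarrow> 'v) \<Rightarrow> ('a \<Rightarrow> 'v) \<Rightarrow> 'a set \<Rightarrow> nat" where
  "surplus V f h E = (\<Sum>j\<in>V. deg f E j - deg h E j)"

text \<open>The degree equations of edge-disjoint cycles together with a path from \<open>u\<close>
  to \<open>v\<close>, or of cycles alone if \<open>u = v\<close>. Removing arcs affects the bounds
  only through degrees.\<close>

definition balanced :: "('a \<Rightarrow> 'v) \<Rightarrow> ('a \<Rightarrow> 'v) \<Rightarrow> 'a set \<Rightarrow> 'v \<Rightarrow> 'v \<Rightarrow> bool" where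
  "balanced f h M u v \<longleftrightarrow> (\<forall>j. deg f M j + of_bool (j = v) = deg h M j + of_bool (j = u))"

definition drains :: "('a \<Rightarrow> 'v) \<Rightarrow> ('a \<Rightarrow> 'v) \<Rightarrow> 'a set \<Rightarrow> 'v \<Rightarrow> 'v \<Rightarrow> bool" where
  "drains f h E u v \<longleftrightarrow> (u \<noteq> v \<longrightarrow> deg h E u < deg f E u \<and> deg f E v < deg h E v)"

lemma simple_walk_balanced:
  "simple_walk f h u xs v \<Longrightarrow> balanced f h (set xs) u v"
  unfolding simple_walk_def balanced_def using chain_deg by (metis distinct_map)

text \<open>At \<open>u\<close> the indegree is the smaller one in \<open>E\<close>, in
  \<open>M\<close> and in \<open>E - M\<close>, at \<open>v\<close> the outdegree is; elsewhere both
  degrees drop by the same amount. So the minima simply subtract.\<close>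

lemma shared_Diff:
  assumes "finite E" "M \<subseteq> E" "balanced f h M u v" "drains f h E u v"
  shows "shared f h (E - M) j \<le> shared f h E j - shared f h M j"
  using assms(3,4) deg_mono[OF assms(1,2), of f j] deg_mono[OF assms(1,2), of h j]
  unfolding balanced_def drains_def shared_def deg_Diff[OF assms(1,2)]
  by (cases "j = u"; cases "j = v") (auto dest!: spec[of _ j])

lemma surplus_Diff_pointwise:
  assumes "finite E" "M \<subseteq> E" "balanced f h M u v" "drains f h E u v"
  shows "deg f (E - M) j - deg h (E - M) j \<le> deg f E j - deg h E j"
    and "u \<noteq> v \<Longrightarrow> deg f (E - M) u - deg h (E - M) u < deg f E u - deg h E u"
proof -
  show "deg f (E - M) j - deg h (E - M) j \<le> deg f E j - deg h E j"
    using assms(3,4) deg_mono[OF assms(1,2), of f j] deg_mono[OF assms(1,2), of h j]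
    unfolding balanced_def drains_def deg_Diff[OF assms(1,2)]
    by (cases "j = u"; cases "j = v") (auto dest!: spec[of _ j])
  show "deg f (E - M) u - deg h (E - M) u < deg f E u - deg h E u" if "u \<noteq> v"
    using that assms(3,4) deg_mono[OF assms(1,2), of f u] deg_mono[OF assms(1,2), of h u]
    unfolding balanced_def drains_def deg_Diff[OF assms(1,2)]
    by (auto dest!: spec[of _ u])
qed

lemma surplus_Diff_le:
  assumes "finite E" "M \<subseteq> E" "balanced f h M u v" "drains f h E u v"
  shows "surplus V f h (E - M) \<le> surplus V f h E"
  unfolding surplus_def by (intro sum_mono surplus_Diff_pointwise(1)[OF assms])

lemma surplus_Diff_less:
  assumes "finite E" "M \<subseteq> E" "balanced f h M u v" "drains f h E u v"
    and "finite V" "u \<in> V" "u \<noteq> v"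
  shows "surplus V f h (E - M) < surplus V f h E"
  unfolding surplus_def
  by (rule sum_strict_mono_ex1)
    (use assms surplus_Diff_pointwise[OF assms(1-4)] in auto)

text \<open>Each surplus completes one degree sum to the sum of the maxima, and both degree sums
  equal \<open>card E\<close>. This is the origin of the factor 1/2 in the bound.\<close>

lemma surplus_swap:
  assumes "finite E" "finite V" "f ` E \<subseteq> V" "h ` E \<subseteq> V"
  shows "surplus V h f E = surplus V f h E"
proof -
  have "surplus V f h E + (\<Sum>j\<in>V. deg h E j) = (\<Sum>j\<in>V. max (deg f E j) (deg h E j))"
    unfolding surplus_def sum.distrib[symmetric] by (rule sum.cong) auto
  moreover have "surplus V h f E + (\<Sum>j\<in>V. deg f E j) = (\<Sum>j\<in>V. max (deg f E j) (deg h E j))"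
    unfolding surplus_def sum.distrib[symmetric] by (rule sum.cong) auto
  ultimately show ?thesis using sum_deg[of E V f] sum_deg[of E V h] assms by simp
qed

lemma draining_path:
  assumes "finite E" "deg h E u < deg f E u"
  obtains xs v where "chain f h u xs v" "set xs \<subseteq> E" "distinct (map f xs)" "v \<notin> f ` set xs"
    "xs \<noteq> []" "u \<noteq> v" "deg f E v < deg h E v"
proof -
  have "card {x \<in> E. h x = u \<and> (u, f x) \<in> (arc_rel f h E)\<^sup>*} \<le> deg h E u"
    unfolding deg_def using assms(1) by (intro card_mono) auto
  then have "card {x \<in> E. h x = u \<and> (u, f x) \<in> (arc_rel f h E)\<^sup>*} < deg f E u"
    using assms(2) by simp
  from reachable_deficit[OF assms(1) this] obtain v
    where v: "(u, v) \<in> (arc_rel f h E)\<^sup>*" "v \<noteq> u" "deg f E v < deg h E v" by blast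
  from reachable_chain[OF v(1)] obtain xs
    where "chain f h u xs v" "set xs \<subseteq> E" "distinct (map f xs)" "v \<notin> f ` set xs" by blast
  moreover from this v(2) have "xs \<noteq> []" by auto
  ultimately show ?thesis using v that by blast
qed

lemma simple_walk_if_path:
  assumes "chain f h u xs v" "distinct (map f xs)" "v \<notin> f ` set xs" "xs \<noteq> []"
  shows "simple_walk f h u xs v"
  using assms unfolding simple_walk_def by (cases xs) auto

lemma simple_walk_if_cycle:
  assumes "chain f h u xs u" "distinct (map f xs)" "xs \<noteq> []"
  shows "simple_walk f h u xs u"
  using assms unfolding simple_walk_def by (cases xs) auto

text \<open>If an arc into \<open>i\<close> starts at a vertex reachable from \<open>i\<close>, it
  closes a cycle through \<open>i\<close>. Otherwise \<open>i\<close> lies on no cycle; then a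
  vertex with too many incoming arcs is reachable from \<open>i\<close>, and \<open>i\<close> is
  reachable from one with too many outgoing arcs. The two halves form a path, since a common vertex
  would put \<open>i\<close> on a cycle.\<close>

lemma walk_through:
  assumes fin: "finite E" and ne: "\<And>x. x \<in> E \<Longrightarrow> f x \<noteq> h x" and sh: "0 < shared f h E i"
  obtains u xs v where "simple_walk f h u xs v" "set xs \<subseteq> E" "drains f h E u v"
    "0 < shared f h (set xs) i"
proof (cases "\<exists>x\<in>E. h x = i \<and> (i, f x) \<in> (arc_rel f h E)\<^sup>*")
  case True
  then obtain x where x: "x \<in> E" "h x = i" "(i, f x) \<in> (arc_rel f h E)\<^sup>*" by blast
  obtain xs where xs: "chain f h (f x) (x # xs) (f x)" "set (x # xs) \<subseteq> E"
      "distinct (map f (x # xs))" "xs \<noteq> []"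
    using simple_cycle[of x E f h] x ne by metis
  have "f (hd xs) = i" using xs(1,4) x(2) by (cases xs) auto
  then have "i \<in> f ` set (x # xs)" "i \<in> h ` set (x # xs)" using x(2) xs(4) by auto
  then have "0 < shared f h (set (x # xs)) i"
    unfolding shared_def using deg_pos_iff[of "set (x # xs)"] by (metis List.finite_set min_less_iff_conj)
  moreover have "simple_walk f h (f x) (x # xs) (f x)"
    using xs by (intro simple_walk_if_cycle) auto
  ultimately show ?thesis using xs(2) by (intro that) (auto simp: drains_def)
next
  case False
  let ?R = "(arc_rel f h E)\<^sup>*"
  have acyclic: "w = i" if "(i, w) \<in> ?R" "(w, i) \<in> ?R" for w
  proof (rule ccontr)
    assume "w \<noteq> i"
    with that(2) obtain y where "(w, y) \<in> ?R" "(y, i) \<in> arc_rel f h E"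
      by (meson rtranclE)
    then show False using that(1) False by (auto simp: arc_rel_def dest: rtrancl_trans)
  qed
  have no_in: "{x \<in> E. h x = i \<and> (i, f x) \<in> ?R} = {}" using False by blast
  then have "card {x \<in> E. h x = i \<and> (i, f x) \<in> ?R} < deg f E i"
    using sh by (simp only: shared_def card.empty min_less_iff_conj)
  from reachable_deficit[OF fin this] obtain v
    where v: "(i, v) \<in> ?R" "v \<noteq> i" "deg f E v < deg h E v" by blast
  \<comment> \<open>Hypothesis of \<open>reachable_deficit\<close> for the reversed graph, obtained
    by exchanging \<open>f\<close> and \<open>h\<close>.\<close>
  have "{x \<in> E. f x = i \<and> (i, h x) \<in> (arc_rel h f E)\<^sup>*} = {}"
  proof safe
    fix x assume x: "x \<in> E" "i = f x" "(f x, h x) \<in> (arc_rel h f E)\<^sup>*"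
    then have "(h x, f x) \<in> ?R"
      unfolding arc_rel_converse[of h f E] by (simp add: rtrancl_converse)
    moreover have "(f x, h x) \<in> ?R" using x(1) by (auto simp: arc_rel_def)
    ultimately show "x \<in> {}" using acyclic[of "h x"] ne[OF x(1)] x(2) by simp
  qed
  then have "card {x \<in> E. f x = i \<and> (i, h x) \<in> (arc_rel h f E)\<^sup>*} < deg h E i"
    using sh by (simp only: shared_def card.empty min_less_iff_conj)
  from reachable_deficit[OF fin this] obtain u
    where u: "(i, u) \<in> (arc_rel h f E)\<^sup>*" "u \<noteq> i" "deg h E u < deg f E u" by blast
  have u': "(u, i) \<in> ?R"
    using u(1) unfolding arc_rel_converse[of h f E] by (simp add: rtrancl_converse)
  obtain q where q: "chain f h u q i" "set q \<subseteq> E" "distinct (map f q)" "i \<notin> f ` set q"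
    using reachable_chain[OF u'] by blast
  obtain p where p: "chain f h i p v" "set p \<subseteq> E" "distinct (map f p)" "v \<notin> f ` set p"
    using reachable_chain[OF v(1)] by blast
  have ne_qp: "q \<noteq> []" "p \<noteq> []" using p q u v by auto
  have "w = i" if "w \<in> insert i (f ` set q)" "w \<in> insert v (f ` set p)" for w
    using acyclic chain_reachable[OF q(1,2) that(1)] chain_reachable[OF p(1,2) that(2)] by blast
  then have disj: "f ` set q \<inter> insert v (f ` set p) = {}" using q(4) by blast
  have "simple_walk f h u (q @ p) v"
    using p q disj ne_qp by (intro simple_walk_if_path) (auto simp: chain_append)
  moreover have "f (hd p) \<in> f ` set p" "h (last q) \<in> h ` set q" using ne_qp by simp_all
  then have "i \<in> f ` set (q @ p)" "i \<in> h ` set (q @ p)"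
    using chain_hd[OF p(1) ne_qp(2)] chain_last[OF q(1) ne_qp(1)] by auto
  then have "0 < shared f h (set (q @ p)) i"
    unfolding shared_def using deg_pos_iff[of "set (q @ p)"] by (metis List.finite_set min_less_iff_conj)
  ultimately show ?thesis
    using p(2) q(2) u v by (intro that[of u "q @ p" v]) (auto simp: drains_def)
qed

text \<open>All surplus tails and all surplus heads are redirected to an extra hub vertex \<open>None\<close>. The
  resulting multigraph is Eulerian, the degree of \<open>Some j\<close> is the shared degree of \<open>j\<close> and the
  degree of \<open>None\<close> is the number of paths; a matching that covers all vertices of maximum degree
  uses the hub at most once.\<close>

lemma max_degree_slice:
  fixes f h :: "'a \<Rightarrow> 'v"
  assumes fin: "finite E" "finite V" and V: "f ` E \<subseteq> V" "h ` E \<subseteq> V"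
    and m: "0 < m" "\<And>j. shared f h E j \<le> m" "surplus V f h E \<le> m"
  obtains M u v where "M \<subseteq> E" "balanced f h M u v" "drains f h E u v"
    "\<And>j. shared f h M j \<le> 1" "\<And>j. shared f h E j = m \<Longrightarrow> shared f h M j = 1"
    "surplus V f h E = m \<Longrightarrow> u \<noteq> v" "u \<noteq> v \<Longrightarrow> u \<in> V"
proof -
  have ex: "\<exists>A. \<forall>j. A j \<subseteq> {x \<in> E. p x = j} \<and> card (A j) = deg p E j - deg q E j"
    for p q :: "'a \<Rightarrow> 'v"
  proof (rule choice, rule allI)
    fix j
    have "deg p E j - deg q E j \<le> card {x \<in> E. p x = j}" by (simp add: deg_def)
    then show "\<exists>A\<subseteq>{x \<in> E. p x = j}. card A = deg p E j - deg q E j"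
      by (metis obtain_subset_with_card_n)
  qed
  obtain A where "\<forall>j. A j \<subseteq> {x \<in> E. f x = j} \<and> card (A j) = deg f E j - deg h E j"
    using ex[of f h] by (rule exE)
  then have A: "\<And>j. A j \<subseteq> {x \<in> E. f x = j}" "\<And>j. card (A j) = deg f E j - deg h E j"
    by simp_all
  obtain B where "\<forall>j. B j \<subseteq> {x \<in> E. h x = j} \<and> card (B j) = deg h E j - deg f E j"
    using ex[of h f] by (rule exE)
  then have B: "\<And>j. B j \<subseteq> {x \<in> E. h x = j}" "\<And>j. card (B j) = deg h E j - deg f E j"
    by simp_all
  \<comment> \<open>\<open>A\<close> and \<open>B\<close> select exactly as many arcs at each vertex
    as exceed the smaller degree; what stays at \<open>Some j\<close> is the shared degree.\<close>
  define t where "t x = (if x \<in> A (f x) then None else Some (f x))" for x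
  define s where "s x = (if x \<in> B (h x) then None else Some (h x))" for x
  have deg_None: "deg (\<lambda>x. if x \<in> D (p x) then None else Some (p x)) E None = surplus V p q E"
    if p: "p ` E \<subseteq> V" and D: "\<And>j. D j \<subseteq> {x \<in> E. p x = j}" "\<And>j. card (D j) = deg p E j - deg q E j"
    for p q :: "'a \<Rightarrow> 'v" and D
  proof -
    have "{x \<in> E. (if x \<in> D (p x) then None else Some (p x)) = None} = \<Union>(D ` V)"
      using D(1) p by (fastforce split: if_splits)
    moreover have "card (\<Union>(D ` V)) = (\<Sum>j\<in>V. card (D j))"
    proof (intro card_UN_disjoint fin ballI impI)
      show "finite (D j)" for j using finite_subset[OF D(1)] fin(1) by simp
      show "D j \<inter> D j' = {}" if "j \<noteq> j'" for j j' using D(1)[of j] D(1)[of j'] that by blast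
    qed
    ultimately show ?thesis using D(2) by (simp add: deg_def surplus_def)
  qed
  have deg_Some: "deg (\<lambda>x. if x \<in> D (p x) then None else Some (p x)) E (Some j) = shared p q E j"
    if D: "\<And>j. D j \<subseteq> {x \<in> E. p x = j}" "\<And>j. card (D j) = deg p E j - deg q E j"
    for p q :: "'a \<Rightarrow> 'v" and D j
  proof -
    have "{x \<in> E. (if x \<in> D (p x) then None else Some (p x)) = Some j} = {x \<in> E. p x = j} - D j"
      by (auto split: if_splits)
    moreover have "finite (D j)" using finite_subset[OF D(1)] fin(1) by simp
    ultimately show ?thesis using D(2)[of j] card_Diff_subset[OF _ D(1), of j]
      by (simp add: deg_def shared_def min_def)
  qed
  have comm: "shared h f E j = shared f h E j" for j by (simp add: shared_def min.commute)
  have tE: "deg t E None = surplus V f h E" "deg t E (Some j) = shared f h E j" for j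
    using deg_None[OF V(1) A] deg_Some[OF A] by (simp_all add: t_def[abs_def])
  have sE: "deg s E None = surplus V f h E" "deg s E (Some j) = shared f h E j" for j
    using deg_None[OF V(2) B] deg_Some[OF B] surplus_swap[OF fin V]
    by (simp_all add: s_def[abs_def] comm)
  have "deg t E n = deg s E n" "deg t E n \<le> m" for n
    using tE sE m by (cases n; simp)+
  from matching_covers_max_degree[OF fin(1) this m(1)] obtain M
    where M: "M \<subseteq> E" "inj_on t M" "inj_on s M" "t ` M = s ` M"
      "\<And>n. deg t E n = m \<Longrightarrow> n \<in> t ` M" by blast
  have finM: "finite M" using M(1) fin(1) by (rule finite_subset)
  \<comment> \<open>Since \<open>r\<close> is injective on \<open>M\<close>, at most one arc of
    \<open>M\<close> is attached to \<open>Some j\<close> and at most one to the hub.\<close>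
  have split: "deg p M j = of_bool (Some j \<in> r ` M) + of_bool (\<exists>x\<in>M. p x = j \<and> r x = None)"
    if r: "\<And>x. r x = None \<or> r x = Some (p x)" and inj: "inj_on r M"
    for p :: "'a \<Rightarrow> 'v" and r j
  proof -
    have r_Some: "y = p x" if "r x = Some y" for x y using r[of x] that by auto
    have one: "card {x \<in> M. p x = j \<and> r x = n} = of_bool (\<exists>x\<in>M. p x = j \<and> r x = n)" for n
    proof (cases "\<exists>x\<in>M. p x = j \<and> r x = n")
      case True
      then obtain x where x: "x \<in> M" "p x = j \<and> r x = n" by blast
      then have "{x \<in> M. p x = j \<and> r x = n} = {x}" using inj by (auto dest: inj_onD)
      then show ?thesis using True by simp
    next
      case False
      then have "{x \<in> M. p x = j \<and> r x = n} = {}" by blast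
      then show ?thesis using False by (simp only: card.empty of_bool_eq)
    qed
    have "{x \<in> M. p x = j} = {x \<in> M. p x = j \<and> r x = Some j} \<union> {x \<in> M. p x = j \<and> r x = None}"
      using r by (auto dest: r_Some)
    then have "deg p M j = card {x \<in> M. p x = j \<and> r x = Some j} + card {x \<in> M. p x = j \<and> r x = None}"
      unfolding deg_def using finM by (subst card_Un_disjoint[symmetric]) auto
    moreover have "(\<exists>x\<in>M. p x = j \<and> r x = Some j) \<longleftrightarrow> Some j \<in> r ` M"
      using r by (metis (no_types, lifting) image_iff option.distinct(1) option.inject)
    ultimately show ?thesis by (simp add: one)
  qed
  have tM: "deg f M j = of_bool (Some j \<in> t ` M) + of_bool (\<exists>x\<in>M. f x = j \<and> t x = None)" for j
    by (rule split[OF _ M(2)]) (simp add: t_def)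
  have sM: "deg h M j = of_bool (Some j \<in> t ` M) + of_bool (\<exists>x\<in>M. h x = j \<and> s x = None)" for j
    unfolding M(4) by (rule split[OF _ M(3)]) (simp add: s_def)
  have src: "deg h E (f x) < deg f E (f x)" if "x \<in> M" "t x = None" for x
  proof -
    have "A (f x) \<noteq> {}" "finite (A (f x))"
      using that finite_subset[OF A(1)[of "f x"]] fin(1) by (auto simp: t_def split: if_splits)
    then show ?thesis using A(2)[of "f x"] by (metis card_gt_0_iff zero_less_diff)
  qed
  have snk: "deg f E (h x) < deg h E (h x)" if "x \<in> M" "s x = None" for x
  proof -
    have "B (h x) \<noteq> {}" "finite (B (h x))"
      using that finite_subset[OF B(1)[of "h x"]] fin(1) by (auto simp: s_def split: if_splits)
    then show ?thesis using B(2)[of "h x"] by (metis card_gt_0_iff zero_less_diff)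
  qed
  show ?thesis
  proof (cases "None \<in> t ` M")
    case False
    then have no: "\<not> (\<exists>x\<in>M. f x = j \<and> t x = None)" "\<not> (\<exists>x\<in>M. h x = j \<and> s x = None)" for j
      using M(4) by (metis image_eqI)+
    have degM: "deg f M j = of_bool (Some j \<in> t ` M)" "deg h M j = of_bool (Some j \<in> t ` M)" for j
      using tM[of j] sM[of j] no[of j] by (simp_all del: bex_simps)
    show ?thesis
    proof (rule that[of M undefined undefined])
      show "shared f h M j = 1" if "shared f h E j = m" for j
        using M(5)[of "Some j"] that tE by (simp add: shared_def degM)
      show "undefined \<noteq> undefined" if "surplus V f h E = m"
        using M(5)[of None] that tE False by simp
    qed (use M(1) degM in \<open>auto simp: balanced_def drains_def shared_def\<close>)
  next
    case True
    \<comment> \<open>Opening the hub turns its outgoing arc \<open>x\<close> into the first arc of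
      the path and its incoming arc \<open>y\<close> into the last one; they may coincide.\<close>
    then obtain x y where x: "x \<in> M" "t x = None" and y: "y \<in> M" "s y = None"
      using M(4) by (metis imageE)
    have ux: "(\<exists>z\<in>M. f z = j \<and> t z = None) \<longleftrightarrow> j = f x" for j
      using x M(2) by (metis inj_onD)
    have uy: "(\<exists>z\<in>M. h z = j \<and> s z = None) \<longleftrightarrow> j = h y" for j
      using y M(3) by (metis inj_onD)
    have degM: "deg f M j = of_bool (Some j \<in> t ` M) + of_bool (j = f x)"
      "deg h M j = of_bool (Some j \<in> t ` M) + of_bool (j = h y)" for j
      using tM[of j] sM[of j] unfolding ux uy .
    have uv: "f x \<noteq> h y" using src[OF x] snk[OF y] by auto
    show ?thesis
    proof (rule that[of M "f x" "h y"])
      show "shared f h M j \<le> 1" for j using uv by (auto simp: shared_def degM)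
      show "shared f h M j = 1" if "shared f h E j = m" for j
        using M(5)[of "Some j"] that tE uv by (auto simp: shared_def degM)
      show "f x \<in> V" using V(1) M(1) x(1) by blast
    qed (use M(1) degM uv src[OF x] snk[OF y] in \<open>auto simp: balanced_def drains_def\<close>)
  qed
qed

subsection \<open>Merging disjoint cycles into two walks\<close>

text \<open>Both kinds of move at once, \<open>u = v\<close> giving the cyclical ones. The differing
  items range over the whole type, so \<open>f\<close> and \<open>g\<close> agree outside
  \<open>X\<close>; \<open>v \<in> V\<close> keeps a path from ending outside the clusters, the
  other vertices being values of \<open>f\<close> on \<open>X\<close>.\<close>

definition walk_moves :: "'v set \<Rightarrow> 'a set \<Rightarrow> (('a \<Rightarrow> 'v) \<times> ('a \<Rightarrow> 'v)) set" where
  "walk_moves V X = {(f, g). \<exists>u xs v. simple_walk f g u xs v \<and> v \<in> V \<and>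
     {x. f x \<noteq> g x} = set xs \<and> set xs \<subseteq> X}"

lemma walk_move_override:
  assumes "simple_walk f h u xs v" "v \<in> V" "set xs \<subseteq> X" "\<And>x. x \<in> set xs \<Longrightarrow> f x \<noteq> h x"
    and "set xs \<inter> N = {}"
  shows "(override_on f h N, override_on f h (N \<union> set xs)) \<in> walk_moves V X"
proof -
  let ?f = "override_on f h N" and ?g = "override_on f h (N \<union> set xs)"
  have f: "?f x = f x" and g: "?g x = h x" if "x \<in> set xs" for x
    using that assms(5) by (auto simp: override_on_def)
  have "map ?f xs = map f xs" using f by simp
  moreover have "chain ?f ?g u xs v \<longleftrightarrow> chain f h u xs v" using f g by (rule chain_cong)
  ultimately have "simple_walk ?f ?g u xs v" using assms(1) unfolding simple_walk_def by presburger
  moreover have "{x. ?f x \<noteq> ?g x} = set xs"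
    using assms(4,5) by (auto simp: override_on_def)
  ultimately show ?thesis using assms(2,3) unfolding walk_moves_def by blast
qed

text \<open>The graph of a permutation without fixed points, that is, vertex-disjoint cycles of
  length at least two.\<close>

definition perm_arcs :: "('a \<Rightarrow> 'v) \<Rightarrow> ('a \<Rightarrow> 'v) \<Rightarrow> 'a set \<Rightarrow> bool" where
  "perm_arcs f h R \<longleftrightarrow> finite R \<and> inj_on f R \<and> inj_on h R \<and> f ` R = h ` R \<and> (\<forall>x\<in>R. f x \<noteq> h x)"

lemma perm_arcs_avoid:
  assumes "perm_arcs f h R" "R \<noteq> {}"
  obtains x where "x \<in> R" "f x \<noteq> b"
proof -
  obtain y where y: "y \<in> R" using assms(2) by blast
  then have "h y \<in> f ` R" "f y \<noteq> h y" using assms(1) by (auto simp: perm_arcs_def)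
  then show ?thesis using y that by (metis imageE)
qed

text \<open>The only arc into \<open>h x\<close> is \<open>x\<close>. If \<open>f x\<close> were not
  reachable from there, \<open>reachable_deficit\<close> would produce a vertex with different
  degrees, but a permutation has none.\<close>

lemma perm_arcs_cycle:
  assumes R: "perm_arcs f h R" and x: "x \<in> R"
  obtains xs where "chain f h (f x) (x # xs) (f x)" "set (x # xs) \<subseteq> R" "distinct (map f (x # xs))"
    "perm_arcs f h (R - set (x # xs))" "f ` set (x # xs) \<inter> f ` (R - set (x # xs)) = {}"
proof -
  have fin: "finite R" and inj: "inj_on f R" "inj_on h R" and img: "f ` R = h ` R"
    and ne: "\<And>x. x \<in> R \<Longrightarrow> f x \<noteq> h x"
    using R by (auto simp: perm_arcs_def)
  have "(h x, f x) \<in> (arc_rel f h R)\<^sup>*"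
  proof (rule ccontr)
    assume "(h x, f x) \<notin> (arc_rel f h R)\<^sup>*"
    then have "{y \<in> R. h y = h x \<and> (h x, f y) \<in> (arc_rel f h R)\<^sup>*} = {}"
      using inj(2) x by (auto dest: inj_onD)
    moreover have "0 < deg f R (h x)"
      using deg_pos_iff[OF fin] x img by (metis image_eqI)
    ultimately have "card {y \<in> R. h y = h x \<and> (h x, f y) \<in> (arc_rel f h R)\<^sup>*} < deg f R (h x)"
      by (simp only: card.empty)
    from reachable_deficit[OF fin this] show False
      by (auto simp: deg_inj_on[OF fin inj(1)] deg_inj_on[OF fin inj(2)] img)
  qed
  then obtain xs where xs: "chain f h (f x) (x # xs) (f x)" "set (x # xs) \<subseteq> R"
      "distinct (map f (x # xs))"
    using simple_cycle[of x R f h, OF x ne[OF x]] by blast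
  let ?S = "set (x # xs)"
  have "h (last (x # xs)) = f x" using chain_last[OF xs(1)] by simp
  then have "f x \<in> f ` ?S" "f x \<in> h ` ?S" by (force, metis image_eqI last_in_set list.discI)
  then have "f ` ?S = h ` ?S" using chain_vertices[OF xs(1)] by (simp add: insert_absorb)
  moreover have "f ` (R - ?S) = f ` R - f ` ?S" "h ` (R - ?S) = h ` R - h ` ?S"
    using inj_on_image_set_diff[OF inj(1), of R ?S] inj_on_image_set_diff[OF inj(2), of R ?S] xs(2)
    by auto
  ultimately have "f ` (R - ?S) = h ` (R - ?S)" "f ` ?S \<inter> f ` (R - ?S) = {}" using img by auto
  moreover have "perm_arcs f h (R - ?S)"
    unfolding perm_arcs_def using fin inj ne calculation(1) by (simp add: inj_on_diff)
  ultimately show ?thesis using xs that by blast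
qed

text \<open>The final vertices \<open>v\<close> and \<open>w\<close> are explicit because later
  cycles have to avoid them. An item common to both walks is the place where the next cycle is
  spliced in.\<close>

definition two_walks ::
  "('a \<Rightarrow> 'v) \<Rightarrow> ('a \<Rightarrow> 'v) \<Rightarrow> 'a set \<Rightarrow> ('a \<Rightarrow> 'v) \<Rightarrow> 'a list \<Rightarrow> 'v \<Rightarrow> 'a list \<Rightarrow> 'v \<Rightarrow> bool" where
  "two_walks f h M g xs v ys w \<longleftrightarrow>
     (\<exists>u. simple_walk f g u xs v) \<and> {x. f x \<noteq> g x} = set xs \<and>
     (\<exists>u. simple_walk g (override_on f h M) u ys w) \<and> {x. g x \<noteq> override_on f h M x} = set ys \<and>
     set xs \<inter> set ys \<noteq> {} \<and> set xs \<union> set ys \<subseteq> M"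

lemma two_walks_moves:
  assumes "two_walks f h M g xs v ys w" "M \<subseteq> X" "v \<in> V" "w \<in> V"
  shows "(f, override_on f h M) \<in> walk_moves V X ^^ 2"
proof -
  have "(f, g) \<in> walk_moves V X" "(g, override_on f h M) \<in> walk_moves V X"
    using assms unfolding two_walks_def walk_moves_def by blast+
  then show ?thesis by (auto simp: numeral_2_eq_2)
qed

text \<open>An item that goes \<open>p \<rightarrow> q\<close> in the first walk and \<open>q \<rightarrow> r\<close> in the second one is
  diverted to a vertex \<open>a\<close> of the cycle; the first walk then runs through the whole cycle, but its
  last item returns to \<open>q\<close> instead of \<open>a\<close>. The second walk repairs this by going
  \<open>q \<rightarrow> a \<rightarrow> r\<close>.\<close>

lemma splice_cycle:
  assumes tw: "two_walks f h M g xs v ys w"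
    and z: "chain f h a z a" "distinct (map f z)" "z \<noteq> []" "\<And>y. y \<in> set z \<Longrightarrow> f y \<noteq> h y"
      "set z \<inter> M = {}"
    and d1: "insert v (f ` set xs) \<inter> f ` set z = {}"
    and d2: "a \<notin> insert w (g ` set ys)"
  shows "\<exists>g' xs' ys'. two_walks f h (M \<union> set z) g' xs' v ys' w \<and>
    f ` set xs' = f ` set xs \<union> f ` set z \<and> g' ` set ys' = insert a (g ` set ys)"
proof -
  obtain zs l where zl: "z = zs @ [l]" using z(3) by (metis rev_exhaust)
  obtain x where x: "x \<in> set xs" "x \<in> set ys" using tw by (auto simp: two_walks_def)
  obtain A B where AB: "xs = A @ x # B" using x(1) by (meson split_list)
  obtain A' B' where AB': "ys = A' @ x # B'" using x(2) by (meson split_list)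
  define h' where "h' = override_on f h M"
  define h'' where "h'' = override_on f h (M \<union> set z)"
  define g' where "g' y = (if y = x then a else if y = l then g x else if y \<in> set zs then h y else g y)" for y
  obtain u\<^sub>1 u\<^sub>2 where w1: "simple_walk f g u\<^sub>1 xs v" and w2: "simple_walk g h' u\<^sub>2 ys w"
    and c1: "{x. f x \<noteq> g x} = set xs" and c2: "{x. g x \<noteq> h' x} = set ys"
    and sub: "set xs \<union> set ys \<subseteq> M"
    using tw by (auto simp: two_walks_def h'_def)
  have dist1: "distinct (map f xs)" and dist2: "distinct (map g ys)"
    using w1 w2 by (auto simp: simple_walk_def)
  have notz: "y \<notin> set z" if "y \<in> set xs \<union> set ys" for y using that sub z(5) by blast
  have xz: "x \<notin> set z" using notz x by blast
  have lzs: "l \<notin> set zs" "f l \<notin> f ` set zs" using z(2) by (auto simp: zl)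
  have a: "a \<in> f ` set z" using chain_hd[OF z(1,3)] z(3) by force
  have hl: "h l = a" using chain_last[OF z(1,3)] by (simp add: zl)
  have ch1: "chain f g u\<^sub>1 A (f x)" "chain f g (g x) B v"
    and ch2: "chain g h' u\<^sub>2 A' (g x)" "chain g h' (h' x) B' w"
    using w1 w2 by (auto simp: simple_walk_def AB AB' chain_append)
  \<comment> \<open>The old target of the diverted item is where the first walk continues or ends,
    hence off the new cycle.\<close>
  have "g x \<in> insert v (f ` set B)"
    using ch1(2) by (cases B) auto
  then have q: "g x \<notin> f ` set z" using d1 by (auto simp: AB)
  then have qa: "g x \<noteq> a" using a by auto
  have g'_old: "g' y = g y" if "y \<in> set xs \<union> set ys" "y \<noteq> x" for y
    using that notz[OF that(1)] by (auto simp: g'_def zl)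
  have h''_old: "h'' y = h' y" if "y \<notin> set z" for y
    using that by (auto simp: h''_def h'_def override_on_def)
  have h''_z: "h'' y = h y" if "y \<in> set z" for y
    using that by (auto simp: h''_def override_on_def)
  have gz: "g y = f y" if "y \<in> set z" for y
    using that notz[of y] c1 by (metis (mono_tags) UnI1 mem_Collect_eq)
  have g': "g' x = a" "g' l = g x" "\<And>y. y \<in> set zs \<Longrightarrow> g' y = h y"
    using xz lzs by (auto simp: g'_def zl)
  have xA: "x \<notin> set A" "x \<notin> set B" "x \<notin> set A'" "x \<notin> set B'"
    using dist1 dist2 by (auto simp: AB AB')
  have zs: "chain f h a zs (f l)" using z(1) by (simp add: zl chain_append)
  have old: "g y = g' y" if "y \<in> set A \<or> y \<in> set B \<or> y \<in> set A' \<or> y \<in> set B'" for y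
    using that xA by (intro g'_old[symmetric]) (auto simp: AB AB')
  have old': "h' y = h'' y" if "y \<in> set A' \<or> y \<in> set B'" for y
    using that by (intro h''_old[symmetric] notz) (auto simp: AB')
  \<comment> \<open>After the first walk, \<open>l\<close> sits at \<open>g x\<close> and
    \<open>x\<close> sits at \<open>a\<close>, so the pair \<open>l\<close>, \<open>x\<close>
    replaces \<open>x\<close> in the second walk. Both are common items, ready for the next
    splice.\<close>
  let ?xs = "A @ x # zs @ [l] @ B" and ?ys = "A' @ l # x # B'"
  have "chain f g' u\<^sub>1 A (f x)"
    by (rule chain_cong[THEN iffD1, OF _ _ ch1(1)]) (simp_all add: old)
  moreover have "chain f g' (g x) B v"
    by (rule chain_cong[THEN iffD1, OF _ _ ch1(2)]) (simp_all add: old)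
  moreover have "chain f g' a zs (f l)"
    by (rule chain_cong[THEN iffD1, OF _ _ zs]) (use g'(3) in auto)
  ultimately have "chain f g' u\<^sub>1 ?xs v" using g'(1,2) by (auto simp: chain_append)
  moreover have "distinct (map f ?xs)"
    using dist1 z(2) d1 by (auto simp: AB zl)
  moreover have "v \<notin> set (tl (map f ?xs))"
    using w1 d1 by (cases A) (auto simp: simple_walk_def AB zl)
  ultimately have s1: "simple_walk f g' u\<^sub>1 ?xs v" by (simp add: simple_walk_def)
  have "chain g' h'' u\<^sub>2 A' (g x)"
    by (rule chain_cong[THEN iffD1, OF _ _ ch2(1)]) (simp_all add: old old')
  moreover have "chain g' h'' (h' x) B' w"
    by (rule chain_cong[THEN iffD1, OF _ _ ch2(2)]) (simp_all add: old old')
  ultimately have "chain g' h'' u\<^sub>2 ?ys w"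
    using g' h''_old[OF xz] h''_z[of l] hl by (auto simp: chain_append zl)
  moreover have map': "map g' ?ys = map g A' @ g x # a # map g B'" by (simp add: old g')
  moreover have "distinct (map g A' @ g x # a # map g B')"
    using dist2 d2 qa by (auto simp: AB')
  moreover have "w \<notin> set (tl (map g A' @ g x # a # map g B'))"
    using w2 d2 by (cases A') (auto simp: simple_walk_def AB')
  ultimately have s2: "simple_walk g' h'' u\<^sub>2 ?ys w"
    unfolding simple_walk_def map' by simp
  have "{y. f y \<noteq> g' y} = set ?xs"
  proof (intro set_eqI)
    fix y
    have "f x \<noteq> a" using d1 a by (auto simp: AB)
    moreover have "f l \<noteq> g x" using q by (auto simp: zl)
    ultimately show "y \<in> {y. f y \<noteq> g' y} \<longleftrightarrow> y \<in> set ?xs"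
      using c1 z(4)[of y] by (auto simp: g'_def AB zl)
  qed
  moreover have "{y. g' y \<noteq> h'' y} = set ?ys"
  proof (intro set_eqI)
    fix y
    have "h' x \<in> insert w (g ` set B')" using ch2(2) by (cases B') auto
    then have "a \<noteq> h' x" using d2 by (auto simp: AB')
    then show "y \<in> {y. g' y \<noteq> h'' y} \<longleftrightarrow> y \<in> set ?ys"
      using c2 qa hl notz[of y] h''_z[of y] h''_old[of y] lzs xz by (auto simp: g'_def AB' zl)
  qed
  ultimately have "two_walks f h (M \<union> set z) g' ?xs v ?ys w"
    unfolding two_walks_def using s1 s2 sub by (auto simp: h''_def AB AB' zl)
  moreover have "f ` set ?xs = f ` set xs \<union> f ` set z" by (auto simp: AB zl)
  moreover have "g' ` set ?ys = insert a (g ` set ys)"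
    using arg_cong[OF map', of set] by (auto simp: AB')
  ultimately show ?thesis by blast
qed

text \<open>The first walk runs round every cycle, so it must be disjoint from \<open>R\<close>. The
  second one only gains the vertex where a cycle is entered, so it may already touch one vertex
  \<open>b\<close> of \<open>R\<close>: no cycle is a loop, hence an entry other than
  \<open>b\<close> exists. The conditions persist because all new vertices lie on the cycle just
  used.\<close>

lemma splice_cycles:
  assumes "perm_arcs f h R" "two_walks f h M g xs v ys w" "R \<inter> M = {}"
    and "insert v (f ` set xs) \<inter> f ` R = {}" "insert w (g ` set ys) \<inter> f ` R \<subseteq> {b}"
  shows "\<exists>g' xs' ys'. two_walks f h (M \<union> R) g' xs' v ys' w"
  using assms
proof (induction "card R" arbitrary: R M g xs ys rule: less_induct)
  case less
  show ?case
  proof (cases "R = {}")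
    case True
    then show ?thesis using less.prems(2) by auto
  next
    case False
    have fin: "finite R" and ne: "\<And>x. x \<in> R \<Longrightarrow> f x \<noteq> h x"
      using less.prems(1) by (auto simp: perm_arcs_def)
    obtain x where x: "x \<in> R" "f x \<noteq> b"
      by (rule perm_arcs_avoid[OF less.prems(1) False])
    from perm_arcs_cycle[OF less.prems(1) x(1)] obtain zs
      where zs: "chain f h (f x) (x # zs) (f x)" "set (x # zs) \<subseteq> R" "distinct (map f (x # zs))"
        "perm_arcs f h (R - set (x # zs))" "f ` set (x # zs) \<inter> f ` (R - set (x # zs)) = {}"
      by blast
    let ?Z = "set (x # zs)"
    have "f x \<notin> insert w (g ` set ys)" using less.prems(5) x by blast
    moreover have "insert v (f ` set xs) \<inter> f ` ?Z = {}" "?Z \<inter> M = {}"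
      using less.prems(3,4) zs(2) by blast+
    moreover have "f y \<noteq> h y" if "y \<in> ?Z" for y using that zs(2) ne by blast
    ultimately have "\<exists>g' xs' ys'. two_walks f h (M \<union> ?Z) g' xs' v ys' w \<and>
        f ` set xs' = f ` set xs \<union> f ` ?Z \<and> g' ` set ys' = insert (f x) (g ` set ys)"
      by (intro splice_cycle[OF less.prems(2) zs(1,3)]) simp_all
    then obtain g' xs' ys' where tw: "two_walks f h (M \<union> ?Z) g' xs' v ys' w"
      and xs': "f ` set xs' = f ` set xs \<union> f ` ?Z" and ys': "g' ` set ys' = insert (f x) (g ` set ys)"
      by (elim exE conjE) (rule that)
    have "R - ?Z \<subset> R" using x(1) by auto
    then have "card (R - ?Z) < card R" using fin by (rule psubset_card_mono[rotated])
    moreover have "(R - ?Z) \<inter> (M \<union> ?Z) = {}" using less.prems(3) by blast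
    moreover have "insert v (f ` set xs') \<inter> f ` (R - ?Z) = {}"
      using less.prems(4) zs(5) unfolding xs' by blast
    moreover have "f x \<notin> f ` (R - ?Z)" using zs(5) by auto
    then have "insert w (g' ` set ys') \<inter> f ` (R - ?Z) \<subseteq> {b}"
      using less.prems(5) unfolding ys' by blast
    ultimately have "\<exists>g' xs' ys'. two_walks f h (M \<union> ?Z \<union> (R - ?Z)) g' xs' v ys' w"
      using less.hyps[OF _ zs(4) tw] by blast
    moreover have "M \<union> ?Z \<union> (R - ?Z) = M \<union> R" using zs(2) by blast
    ultimately show ?thesis by simp
  qed
qed

text \<open>Without the path, indegrees and outdegrees agree and are at most one, which is a
  permutation. A vertex inside the path has no arcs left, but \<open>u\<close> and \<open>v\<close>
  can have one more. The tails of \<open>p\<close> include \<open>u\<close> and not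
  \<open>v\<close>, so contact at \<open>v\<close> is not excluded by the last property.\<close>

lemma slice_path_cycles:
  assumes fin: "finite M" and bal: "balanced f h M u v" and le: "\<And>j. shared f h M j \<le> 1"
    and ne: "\<And>x. x \<in> M \<Longrightarrow> f x \<noteq> h x"
  obtains p R where "M = set p \<union> R" "set p \<inter> R = {}" "chain f h u p v" "distinct (map f p)"
    "v \<notin> f ` set p" "perm_arcs f h R" "f ` set p \<inter> f ` R \<subseteq> {u}"
proof -
  have bal_j: "deg f M j + of_bool (j = v) = deg h M j + of_bool (j = u)" for j
    using bal by (simp add: balanced_def)
  obtain p where p: "chain f h u p v" "set p \<subseteq> M" "distinct (map f p)" "v \<notin> f ` set p"
  proof (cases "u = v")
    case True
    then show ?thesis by (intro that[of "[]"]) auto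
  next
    case False
    then have "deg h M u < deg f M u" using bal_j[of u] by simp
    from draining_path[OF fin this] obtain p v' where p: "chain f h u p v'" "set p \<subseteq> M"
        "distinct (map f p)" "v' \<notin> f ` set p" "deg f M v' < deg h M v'" by metis
    \<comment> \<open>\<open>v\<close> is the only vertex where \<open>M\<close> has more incoming
      than outgoing arcs.\<close>
    moreover have "v' = v" using p(5) bal_j[of v'] by (cases "v' = v") auto
    ultimately show ?thesis by (intro that) auto
  qed
  let ?R = "M - set p"
  have p_deg: "deg f (set p) j + of_bool (j = v) = deg h (set p) j + of_bool (j = u)" for j
    using chain_deg[OF p(1)] p(3) by (simp add: distinct_map)
  have R_deg: "deg f ?R j = deg f M j - deg f (set p) j" "deg h ?R j = deg h M j - deg h (set p) j" for j
    by (rule deg_Diff[OF fin p(2)])+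
  have mono: "deg f (set p) j \<le> deg f M j" "deg h (set p) j \<le> deg h M j" for j
    by (rule deg_mono[OF fin p(2)])+
  have eq: "deg f ?R j = deg h ?R j" for j
    unfolding R_deg using bal_j[of j] p_deg[of j] mono[of j]
    by (cases "j = u"; cases "j = v") auto
  have u: "0 < deg f (set p) u" if "u \<noteq> v"
    using p_deg[of u] that by simp
  have R_le: "deg f ?R j \<le> 1" for j
    using le[of j] bal_j[of j] mono[of j] u unfolding R_deg(1) shared_def
    by (cases "j = u"; cases "j = v") auto
  have R_zero: "j \<notin> f ` ?R" if "j \<in> f ` set p" "j \<noteq> u" for j
  proof -
    have "j \<noteq> v" using that(1) p(4) by auto
    moreover have "0 < deg f (set p) j" using that(1) deg_pos_iff[of "set p" f j] by simp
    ultimately have "deg f ?R j = 0"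
      using le[of j] bal_j[of j] that(2) unfolding R_deg(1) shared_def by simp
    then show ?thesis using deg_pos_iff[of ?R f j] fin by simp
  qed
  have finR: "finite ?R" using fin by simp
  have "perm_arcs f h ?R"
    unfolding perm_arcs_def
  proof (intro conjI ballI)
    show "inj_on f ?R" using finR R_le by (rule inj_on_if_deg_le_1)
    show "inj_on h ?R" using finR R_le unfolding eq by (rule inj_on_if_deg_le_1)
    have "j \<in> f ` ?R \<longleftrightarrow> j \<in> h ` ?R" for j
      using deg_pos_iff[OF finR, of f j] deg_pos_iff[OF finR, of h j] eq[of j] by simp
    then show "f ` ?R = h ` ?R" by blast
  qed (use fin ne in auto)
  then show ?thesis using p R_zero by (intro that[of p ?R]) auto
qed

text \<open>The first walk is \<open>z\<close> followed by \<open>r\<close>, where the last item of \<open>z\<close> goes to \<open>y\<close>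
  instead of \<open>a\<close>; the second walk is \<open>p\<close> followed by that item.\<close>

lemma two_walks_disjoint_cycle:
  assumes p: "chain f h u p y" "distinct (map f p)" "y \<notin> f ` set p" "p \<noteq> []"
    and r: "chain f h y r v" "distinct (map f r)" "v \<notin> f ` set r"
    and z: "chain f h a z a" "distinct (map f z)" "z \<noteq> []"
    and disj: "set p \<inter> set r = {}" "set p \<inter> set z = {}" "insert v (f ` set r) \<inter> f ` set z = {}"
      "a \<notin> f ` set p"
    and ne: "\<And>x. x \<in> set p \<union> set r \<union> set z \<Longrightarrow> f x \<noteq> h x"
  shows "\<exists>g xs ys. two_walks f h (set p \<union> set r \<union> set z) g xs v ys a \<and>
    f ` set xs = f ` set z \<union> f ` set r \<and> g ` set ys = insert y (f ` set p)"
proof -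
  obtain zs l where zl: "z = zs @ [l]" using z(3) by (metis rev_exhaust)
  define g where "g x = (if x = l then y else if x \<in> set zs \<union> set r then h x else f x)" for x
  define h' where "h' = override_on f h (set p \<union> set r \<union> set z)"
  let ?xs = "zs @ [l] @ r" and ?ys = "p @ [l]"
  have yz: "y \<notin> f ` set z" using r(1) disj(3) by (cases r) auto
  have a: "a \<in> f ` set z" using chain_hd[OF z(1,3)] z(3) by force
  have hl: "h l = a" using chain_last[OF z(1,3)] by (simp add: zl)
  have zr: "set z \<inter> set r = {}" using disj(3) by blast
  have lzs: "l \<notin> set zs" using z(2) by (auto simp: zl)
  have g: "g x = h x" if "x \<in> set zs \<or> x \<in> set r" for x
    using that lzs zr by (auto simp: g_def zl)
  have gp: "g x = f x" if "x \<in> set p" for x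
    using that disj(1,2) by (auto simp: g_def zl)
  have gl: "g l = y" by (simp add: g_def)
  have h'p: "h' x = h x" if "x \<in> set p \<union> set r \<union> set z" for x
    using that by (simp add: h'_def)
  have zs: "chain f h a zs (f l)" using z(1) by (simp add: zl chain_append)
  have "chain f g a zs (f l)" by (rule chain_cong[THEN iffD1, OF _ _ zs]) (simp_all add: g)
  moreover have "chain f g y r v" by (rule chain_cong[THEN iffD1, OF _ _ r(1)]) (simp_all add: g)
  ultimately have "chain f g a ?xs v" using gl by (auto simp: chain_append)
  then have s1: "simple_walk f g a ?xs v"
    using z(2) r(2,3) disj(3) by (intro simple_walk_if_path) (auto simp: zl)
  have "chain g h' u p y"
    by (rule chain_cong[THEN iffD1, OF _ _ p(1)]) (simp_all add: gp h'p)
  then have "chain g h' u ?ys a" using gl hl by (auto simp: chain_append h'p zl)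
  moreover have mapg: "map g ?ys = map f p @ [y]" by (simp add: gp gl)
  moreover have set_ys: "g ` set ?ys = insert y (f ` set p)"
    using arg_cong[OF mapg, of set] by auto
  moreover have "a \<notin> insert y (f ` set p)" using disj(4) yz a by auto
  moreover have "distinct (map g ?ys)" unfolding mapg using p(2,3) by auto
  ultimately have s2: "simple_walk g h' u ?ys a"
    by (intro simple_walk_if_path) (simp_all only: append_is_Nil_conv list.discI simp_thms)
  have fl: "f l \<noteq> y" using yz by (auto simp: zl)
  have "{x. f x \<noteq> g x} = set ?xs"
  proof (intro set_eqI)
    fix x show "x \<in> {x. f x \<noteq> g x} \<longleftrightarrow> x \<in> set ?xs"
      using ne[of x] fl by (auto simp: g_def zl)
  qed
  moreover have "{x. g x \<noteq> h' x} = set ?ys"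
  proof (intro set_eqI)
    fix x
    have "y \<noteq> a" using yz a by auto
    then show "x \<in> {x. g x \<noteq> h' x} \<longleftrightarrow> x \<in> set ?ys"
      using ne[of x] hl disj(1,2) lzs by (auto simp: g_def h'_def zl override_on_def)
  qed
  ultimately have "two_walks f h (set p \<union> set r \<union> set z) g ?xs v ?ys a"
    unfolding two_walks_def h'_def[symmetric] using s1 s2 by (auto simp: zl)
  moreover have "f ` set ?xs = f ` set z \<union> f ` set r" by (auto simp: zl)
  ultimately show ?thesis using set_ys by blast
qed

text \<open>The first walk is \<open>p\<close>, then \<open>e\<close> (diverted to \<open>a\<close>), then \<open>z\<close> without its last item
  \<open>l\<close>; the second walk is \<open>l\<close>, then \<open>e\<close> (from \<open>a\<close> to \<open>h e\<close>), then \<open>r\<close>.\<close>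

lemma two_walks_common_cycle:
  assumes p: "chain f h u p v" "distinct (map f p)" "v \<notin> f ` set p"
    and r: "chain f h v (e # r) v" "distinct (map f (e # r))"
    and z: "chain f h a z a" "distinct (map f z)" "z \<noteq> []"
    and disj: "set p \<inter> set (e # r) = {}"
      "f ` set (e # r) \<inter> f ` set z = {}" "f ` set p \<inter> f ` set z = {}"
    and ne: "\<And>x. x \<in> set p \<union> set (e # r) \<union> set z \<Longrightarrow> f x \<noteq> h x"
  shows "\<exists>g xs ys w. two_walks f h (set p \<union> set (e # r) \<union> set z) g xs w ys v \<and> w \<in> f ` set z \<and>
    f ` set xs \<subseteq> f ` set p \<union> f ` set (e # r) \<union> f ` set z \<and>
    g ` set ys \<subseteq> f ` set (e # r) \<union> f ` set z"
proof -
  obtain zs l where zl: "z = zs @ [l]" using z(3) by (metis rev_exhaust)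
  define M where "M = set p \<union> set (e # r) \<union> set z"
  define g where "g x = (if x = e then a else if x \<in> set p \<union> set zs then h x else f x)" for x
  define h' where "h' = override_on f h M"
  let ?xs = "p @ [e] @ zs" and ?ys = "[l, e] @ r"
  have a: "a \<in> f ` set z" using chain_hd[OF z(1,3)] z(3) by force
  have hl: "h l = a" using chain_last[OF z(1,3)] by (simp add: zl)
  have fe: "f e = v" and er: "chain f h (h e) r v" using r(1) by auto
  have vz: "v \<notin> f ` set z" using disj(2) fe by auto
  have av: "a \<noteq> v" using a vz by auto
  have zr: "set z \<inter> set (e # r) = {}" using disj(2) by blast
  have zp: "set z \<inter> set p = {}" using disj(3) by blast
  have lzs: "l \<notin> set zs" "f l \<notin> f ` set zs" using z(2) by (auto simp: zl)
  have er': "e \<notin> set r" "v \<notin> f ` set r" "distinct (map f r)" using r(2) fe by auto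
  have g: "g x = h x" if "x \<in> set p \<or> x \<in> set zs" for x
    using that disj(1) zr by (auto simp: g_def zl)
  have ge: "g e = a" by (simp add: g_def)
  have gl: "g l = f l" using lzs zr zp by (auto simp: g_def zl)
  have gr: "g x = f x" if "x \<in> set r" for x
    using that er' disj(1) zr by (auto simp: g_def zl)
  have h'M: "h' x = h x" if "x \<in> M" for x using that by (simp add: h'_def)
  have M: "e \<in> M" "l \<in> M" "set r \<subseteq> M" by (auto simp: M_def zl)
  have zs: "chain f h a zs (f l)" using z(1) by (simp add: zl chain_append)
  have "chain f g a zs (f l)" by (rule chain_cong[THEN iffD1, OF _ _ zs]) (simp_all add: g)
  moreover have "chain f g u p v" by (rule chain_cong[THEN iffD1, OF _ _ p(1)]) (simp_all add: g)
  ultimately have "chain f g u ?xs (f l)" using ge fe by (auto simp: chain_append)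
  moreover have "distinct (map f ?xs)" using p(2,3) z(2) vz disj(3) fe by (auto simp: zl)
  moreover have "f l \<notin> f ` set ?xs"
  proof -
    have "f l \<in> f ` set z" by (simp add: zl)
    then have "f l \<noteq> v" "f l \<notin> f ` set p" using vz disj(3) by auto
    then show ?thesis using lzs(2) fe by auto
  qed
  ultimately have s1: "simple_walk f g u ?xs (f l)" by (intro simple_walk_if_path) auto
  have "chain g h' (h e) r v"
    by (rule chain_cong[THEN iffD1, OF _ _ er]) (use M(3) in \<open>auto simp: gr h'M\<close>)
  then have "chain g h' (f l) ?ys v" using gl ge hl h'M M by auto
  moreover have mapg: "map g ?ys = [f l, a] @ map f r" by (simp add: ge gl gr)
  moreover have "f l \<noteq> a" using ne[of l] hl by (auto simp: zl)
  moreover have flz: "f l \<in> f ` set z" by (simp add: zl)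
  moreover have "f ` set r \<inter> f ` set z = {}" using disj(2) by auto
  then have "f l \<notin> f ` set r" "a \<notin> f ` set r" using a flz by blast+
  ultimately have "distinct (map g ?ys)" unfolding mapg using er'(3) by simp
  moreover have set_ys: "g ` set ?ys = {f l, a} \<union> f ` set r"
    using arg_cong[OF mapg, of set] by auto
  moreover have "f l \<noteq> v" using vz by (auto simp: zl)
  ultimately have s2: "simple_walk g h' (f l) ?ys v"
    using er'(2) av \<open>chain g h' (f l) ?ys v\<close> \<open>distinct (map g ?ys)\<close>
    by (intro simple_walk_if_path) simp_all
  have "{x. f x \<noteq> g x} = set ?xs"
  proof (intro set_eqI)
    fix x show "x \<in> {x. f x \<noteq> g x} \<longleftrightarrow> x \<in> set ?xs"
      using ne[of x] fe av by (auto simp: g_def zl)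
  qed
  moreover have "{x. g x \<noteq> h' x} = set ?ys"
  proof (intro set_eqI)
    fix x
    have "h e \<in> f ` set (e # r)" using er fe by (cases r) auto
    then have "a \<noteq> h e" using disj(2) a by blast
    then show "x \<in> {x. g x \<noteq> h' x} \<longleftrightarrow> x \<in> set ?ys"
      using ne[of x] disj(1) lzs(1) zr zp er'(1)
      by (auto simp: g_def h'_def M_def zl override_on_def)
  qed
  ultimately have "two_walks f h M g ?xs (f l) ?ys v"
    unfolding two_walks_def h'_def[symmetric] using s1 s2 by (auto simp: zl M_def)
  moreover have "f ` set ?xs \<subseteq> f ` set p \<union> f ` set (e # r) \<union> f ` set z" by (auto simp: zl)
  moreover have "g ` set ?ys \<subseteq> f ` set (e # r) \<union> f ` set z" using set_ys a by (auto simp: zl)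
  moreover have "f l \<in> f ` set z" by (simp add: zl)
  ultimately show ?thesis unfolding M_def by blast
qed

section \<open>Realising a slice by at most two moves\<close>

lemma relpow_trans: "(a, b) \<in> R ^^ m \<Longrightarrow> (b, c) \<in> R ^^ n \<Longrightarrow> (a, c) \<in> R ^^ (m + n)"
  by (auto simp: relpow_add)

lemma chain_start: "chain f h u xs v \<Longrightarrow> u \<in> insert v (f ` set xs)"
  by (cases xs) auto

lemma chain_move:
  assumes "chain f h u xs v" "distinct (map f xs)" "v \<notin> f ` set xs \<or> u = v" "v \<in> V" "set xs \<subseteq> X"
    "\<And>x. x \<in> set xs \<Longrightarrow> f x \<noteq> h x" "set xs \<inter> N = {}"
  shows "\<exists>n\<le>1. (override_on f h N, override_on f h (N \<union> set xs)) \<in> walk_moves V X ^^ n"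
proof (cases "xs = []")
  case True
  then show ?thesis by (intro exI[of _ 0]) simp
next
  case False
  then have "simple_walk f h u xs v"
    using assms(1-3) simple_walk_if_path simple_walk_if_cycle by metis
  then have "(override_on f h N, override_on f h (N \<union> set xs)) \<in> walk_moves V X"
    by (rule walk_move_override) (use assms in auto)
  then show ?thesis by (intro exI[of _ 1]) simp
qed

lemma two_chain_moves:
  assumes p: "chain f h u p y" "distinct (map f p)" "y \<notin> f ` set p" "y \<in> V"
    and r: "chain f h y' r v" "distinct (map f r)" "v \<notin> f ` set r \<or> y' = v" "v \<in> V"
    and "set p \<inter> set r = {}" "set p \<union> set r \<subseteq> X" "\<And>x. x \<in> set p \<union> set r \<Longrightarrow> f x \<noteq> h x"
  shows "\<exists>n\<le>2. (f, override_on f h (set p \<union> set r)) \<in> walk_moves V X ^^ n"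
proof -
  have "\<exists>m\<le>1. (override_on f h {}, override_on f h ({} \<union> set p)) \<in> walk_moves V X ^^ m"
    by (rule chain_move[OF p(1,2)]) (use assms in auto)
  moreover have "\<exists>n\<le>1. (override_on f h (set p), override_on f h (set p \<union> set r)) \<in> walk_moves V X ^^ n"
    by (rule chain_move[OF r(1,2)]) (use assms in auto)
  ultimately obtain m n where "m \<le> 1" "n \<le> 1"
      "(f, override_on f h (set p)) \<in> walk_moves V X ^^ m"
      "(override_on f h (set p), override_on f h (set p \<union> set r)) \<in> walk_moves V X ^^ n"
    by auto
  then show ?thesis using relpow_trans by (intro exI[of _ "m + n"]) auto
qed

text \<open>Meant for a walk from \<open>u\<close> to \<open>v\<close> that is cut at
  \<open>y\<close> into \<open>q\<close> and \<open>r\<close>. The first move covers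
  \<open>r\<close> and the cycles of \<open>S\<close>, the second one covers \<open>q\<close>; hence
  \<open>S\<close> must avoid \<open>r\<close> and \<open>v\<close>, but may meet the vertices of
  \<open>q\<close> in a single one, \<open>b\<close>.\<close>

lemma disjoint_cycles_moves:
  assumes q: "chain f h u q y" "distinct (map f q)" "y \<notin> f ` set q" "q \<noteq> []"
    and r: "chain f h y r v" "distinct (map f r)" "v \<notin> f ` set r"
    and S: "perm_arcs f h S" "insert v (f ` set r) \<inter> f ` S = {}" "insert y (f ` set q) \<inter> f ` S \<subseteq> {b}"
    and disj: "set q \<inter> set r = {}" "set q \<inter> S = {}"
    and ne: "\<And>x. x \<in> set q \<union> set r \<Longrightarrow> f x \<noteq> h x"
    and V: "y \<in> V" "v \<in> V" "f ` S \<subseteq> V" and X: "set q \<union> set r \<union> S \<subseteq> X"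
  shows "\<exists>n\<le>2. (f, override_on f h (set q \<union> set r \<union> S)) \<in> walk_moves V X ^^ n"
proof (cases "S = {}")
  case True
  have "\<exists>n\<le>2. (f, override_on f h (set q \<union> set r)) \<in> walk_moves V X ^^ n"
    by (rule two_chain_moves[OF q(1-3) _ r(1,2)]) (use assms in auto)
  then show ?thesis using True by simp
next
  case False
  from perm_arcs_avoid[OF S(1) this] obtain x where x: "x \<in> S" "f x \<noteq> b" .
  from perm_arcs_cycle[OF S(1) x(1)] obtain zs where zs: "chain f h (f x) (x # zs) (f x)"
      "set (x # zs) \<subseteq> S" "distinct (map f (x # zs))" "perm_arcs f h (S - set (x # zs))"
      "f ` set (x # zs) \<inter> f ` (S - set (x # zs)) = {}" .
  let ?Z = "set (x # zs)"
  have neS: "f x \<noteq> h x" if "x \<in> S" for x using S(1) that by (auto simp: perm_arcs_def)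
  have "set q \<inter> ?Z = {}" "insert v (f ` set r) \<inter> f ` ?Z = {}" using disj(2) S(2) zs(2) by blast+
  moreover have "f x \<notin> f ` set q" using S(3) x by blast
  moreover have "f x \<noteq> h x" if "x \<in> set q \<union> set r \<union> ?Z" for x using that ne neS zs(2) by blast
  ultimately have "\<exists>g xs ys. two_walks f h (set q \<union> set r \<union> ?Z) g xs v ys (f x) \<and>
      f ` set xs = f ` ?Z \<union> f ` set r \<and> g ` set ys = insert y (f ` set q)"
    by (intro two_walks_disjoint_cycle[OF q r zs(1,3) list.distinct(2) disj(1)])
  then obtain g xs ys where tw: "two_walks f h (set q \<union> set r \<union> ?Z) g xs v ys (f x)"
    and xs: "f ` set xs = f ` ?Z \<union> f ` set r" and ys: "g ` set ys = insert y (f ` set q)"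
    by (elim exE conjE) (rule that)
  have "set r \<inter> S = {}" using S(2) by blast
  then have "(S - ?Z) \<inter> (set q \<union> set r \<union> ?Z) = {}" using disj(2) by blast
  moreover have "insert v (f ` set xs) \<inter> f ` (S - ?Z) = {}"
    unfolding xs using S(2) zs(5) by blast
  moreover have "f x \<notin> f ` (S - ?Z)" using zs(5) by auto
  then have "insert (f x) (g ` set ys) \<inter> f ` (S - ?Z) \<subseteq> {b}"
    unfolding ys using S(3) by blast
  ultimately have "\<exists>g' xs' ys'. two_walks f h (set q \<union> set r \<union> ?Z \<union> (S - ?Z)) g' xs' v ys' (f x)"
    by (rule splice_cycles[OF zs(4) tw])
  then obtain g' xs' ys'
    where tw': "two_walks f h (set q \<union> set r \<union> ?Z \<union> (S - ?Z)) g' xs' v ys' (f x)"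
    by (elim exE)
  have "f x \<in> V" using V(3) x(1) by blast
  moreover have "set q \<union> set r \<union> ?Z \<union> (S - ?Z) = set q \<union> set r \<union> S" using zs(2) by blast
  ultimately have "(f, override_on f h (set q \<union> set r \<union> S)) \<in> walk_moves V X ^^ 2"
    using two_walks_moves[OF tw' _ V(2)] X by simp
  then show ?thesis by blast
qed

text \<open>For a path ending on the cycle \<open>e # r\<close>, possibly also starting there. After
  one cycle of \<open>S\<close> is merged in, the first walk ends on that cycle, hence off all the
  others, which can then be spliced in.\<close>

lemma common_cycle_moves:
  assumes p: "chain f h u p v" "distinct (map f p)" "v \<notin> f ` set p"
    and r: "chain f h v (e # r) v" "distinct (map f (e # r))"
    and S: "perm_arcs f h S" "f ` set (e # r) \<inter> f ` S = {}" "f ` set p \<inter> f ` S = {}"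
    and disj: "set p \<inter> set (e # r) = {}"
    and ne: "\<And>x. x \<in> set p \<union> set (e # r) \<Longrightarrow> f x \<noteq> h x"
    and V: "v \<in> V" "f ` S \<subseteq> V" and X: "set p \<union> set (e # r) \<union> S \<subseteq> X"
  shows "\<exists>n\<le>2. (f, override_on f h (set p \<union> set (e # r) \<union> S)) \<in> walk_moves V X ^^ n"
proof (cases "S = {}")
  case True
  have "\<exists>n\<le>2. (f, override_on f h (set p \<union> set (e # r))) \<in> walk_moves V X ^^ n"
    by (rule two_chain_moves[OF p _ r]) (use assms in auto)
  then show ?thesis using True by simp
next
  case False
  then obtain x where x: "x \<in> S" by blast
  from perm_arcs_cycle[OF S(1) x(1)] obtain zs where zs: "chain f h (f x) (x # zs) (f x)"
      "set (x # zs) \<subseteq> S" "distinct (map f (x # zs))" "perm_arcs f h (S - set (x # zs))"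
      "f ` set (x # zs) \<inter> f ` (S - set (x # zs)) = {}" .
  let ?Z = "set (x # zs)"
  have neS: "f x \<noteq> h x" if "x \<in> S" for x using S(1) that by (auto simp: perm_arcs_def)
  have d: "f ` set (e # r) \<inter> f ` ?Z = {}" "f ` set p \<inter> f ` ?Z = {}"
    using S(2,3) zs(2) by blast+
  have "f x \<noteq> h x" if "x \<in> set p \<union> set (e # r) \<union> ?Z" for x using that ne neS zs(2) by blast
  then have "\<exists>g xs ys w. two_walks f h (set p \<union> set (e # r) \<union> ?Z) g xs w ys v \<and> w \<in> f ` ?Z \<and>
      f ` set xs \<subseteq> f ` set p \<union> f ` set (e # r) \<union> f ` ?Z \<and>
      g ` set ys \<subseteq> f ` set (e # r) \<union> f ` ?Z"
    by (intro two_walks_common_cycle[OF p r zs(1,3) list.distinct(2) disj d])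
  then obtain g xs ys w where tw: "two_walks f h (set p \<union> set (e # r) \<union> ?Z) g xs w ys v"
    and w: "w \<in> f ` ?Z" and xs: "f ` set xs \<subseteq> f ` set p \<union> f ` set (e # r) \<union> f ` ?Z"
    and ys: "g ` set ys \<subseteq> f ` set (e # r) \<union> f ` ?Z"
    by (elim exE conjE) (rule that)
  have "(S - ?Z) \<inter> (set p \<union> set (e # r) \<union> ?Z) = {}" using S(2,3) by blast
  moreover
  have avoid: "A \<inter> f ` (S - ?Z) = {}"
    if "A \<subseteq> f ` set p \<union> f ` set (e # r) \<union> f ` ?Z" for A
  proof -
    have "f ` set p \<inter> f ` (S - ?Z) = {}" "f ` set (e # r) \<inter> f ` (S - ?Z) = {}"
      using S(2,3) by blast+
    then show ?thesis using that zs(5) by (meson Int_Un_eq(1) Un_empty disjoint_iff subsetD UnE)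
  qed
  have "insert w (f ` set xs) \<inter> f ` (S - ?Z) = {}"
    by (rule avoid[OF insert_subsetI[OF UnI2[OF w] xs]])
  moreover have "g ` set ys \<inter> f ` (S - ?Z) = {}"
    using ys by (intro avoid) blast
  then have "insert v (g ` set ys) \<inter> f ` (S - ?Z) \<subseteq> {v}" by blast
  ultimately have "\<exists>g' xs' ys'. two_walks f h (set p \<union> set (e # r) \<union> ?Z \<union> (S - ?Z)) g' xs' w ys' v"
    by (rule splice_cycles[OF zs(4) tw])
  then obtain g' xs' ys'
    where tw': "two_walks f h (set p \<union> set (e # r) \<union> ?Z \<union> (S - ?Z)) g' xs' w ys' v"
    by (elim exE)
  have "w \<in> V" using V(2) w zs(2) by blast
  moreover have "set p \<union> set (e # r) \<union> ?Z \<union> (S - ?Z) = set p \<union> set (e # r) \<union> S"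
    using zs(2) by blast
  ultimately have "(f, override_on f h (set p \<union> set (e # r) \<union> S)) \<in> walk_moves V X ^^ 2"
    using two_walks_moves[OF tw' _ _ V(1)] X by simp
  then show ?thesis by blast
qed

lemma slice_moves:
  assumes fin: "finite M" and bal: "balanced f h M u v" and le: "\<And>j. shared f h M j \<le> 1"
    and ne: "\<And>x. x \<in> M \<Longrightarrow> f x \<noteq> h x"
    and V: "f ` M \<subseteq> V" "h ` M \<subseteq> V" and X: "M \<subseteq> X"
  shows "\<exists>n\<le>2. (f, override_on f h M) \<in> walk_moves V X ^^ n"
proof -
  obtain p R where
    M: "M = set p \<union> R" "set p \<inter> R = {}" and
    p: "chain f h u p v" "distinct (map f p)" "v \<notin> f ` set p" and
    R: "perm_arcs f h R" "f ` set p \<inter> f ` R \<subseteq> {u}"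
    by (rule slice_path_cycles[OF fin bal le ne])
  have vV: "v \<in> V" if "p \<noteq> []"
    using chain_last[OF p(1) that] that V(2) M(1) by (metis UnI1 image_subset_iff last_in_set)
  show ?thesis
  proof (cases "p = []")
    case True
    show ?thesis
    proof (cases "R = {}")
      case True
      then show ?thesis using \<open>p = []\<close> M(1) by (intro exI[of _ 0]) simp
    next
      case False
      then obtain e where e: "e \<in> R" by blast
      from perm_arcs_cycle[OF R(1) e] obtain r where r: "chain f h (f e) (e # r) (f e)"
        "set (e # r) \<subseteq> R" "distinct (map f (e # r))" "perm_arcs f h (R - set (e # r))"
        "f ` set (e # r) \<inter> f ` (R - set (e # r)) = {}" .
      \<comment> \<open>With no path, a cycle takes its place: it is cut after its first arc
        \<open>e\<close>, and \<open>r\<close> leads back to \<open>f e\<close>.\<close>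
      have er: "chain f h (h e) r (f e)" using r(1) by simp
      have he: "h e \<in> f ` set (e # r)" using chain_start[OF er] by auto
      have "e \<in> M" using e M(1) by blast
      then have "f e \<in> V" "h e \<in> V" "f e \<noteq> h e" using V ne by blast+
      moreover have "set [e] \<union> set r \<union> (R - set (e # r)) = M" using r(2) M(1) True by auto
      moreover have "\<exists>n\<le>2. (f, override_on f h (set [e] \<union> set r \<union> (R - set (e # r)))) \<in> walk_moves V X ^^ n"
      proof (rule disjoint_cycles_moves[OF _ _ _ _ er _ _ r(4)])
        show "chain f h (f e) [e] (h e)" by simp
        show "insert (f e) (f ` set r) \<inter> f ` (R - set (e # r)) = {}" using r(5) by simp
        have "f ` set [e] \<subseteq> f ` set (e # r)" by auto
        then show "insert (h e) (f ` set [e]) \<inter> f ` (R - set (e # r)) \<subseteq> {f e}"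
          using r(5) he by blast
        show "f x \<noteq> h x" if "x \<in> set [e] \<union> set r" for x
          using that r(2) ne M(1) by auto
        show "set [e] \<union> set r \<union> (R - set (e # r)) \<subseteq> X" using X M(1) r(2) by auto
        show "f ` (R - set (e # r)) \<subseteq> V" using V(1) M(1) by auto
      qed (use calculation r(3) in auto)
      ultimately show ?thesis by simp
    qed
  next
    case False
    note vV = vV[OF False]
    show ?thesis
    proof (cases "v \<in> f ` R")
      case False
      have "\<exists>n\<le>2. (f, override_on f h (set p \<union> set [] \<union> R)) \<in> walk_moves V X ^^ n"
        by (rule disjoint_cycles_moves[OF p \<open>p \<noteq> []\<close>, where v = v and b = u])
          (use False R M ne V vV X in auto)
      then show ?thesis using M(1) by simp
    next
      case True
      then obtain e where e: "e \<in> R" "f e = v" by blast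
      from perm_arcs_cycle[OF R(1) e(1)] obtain r where r: "chain f h v (e # r) v"
        "set (e # r) \<subseteq> R" "distinct (map f (e # r))" "perm_arcs f h (R - set (e # r))"
        "f ` set (e # r) \<inter> f ` (R - set (e # r)) = {}" unfolding e(2) .
      have er: "chain f h (h e) r v" using r(1) by simp
      have he: "h e \<in> f ` set (e # r)" using chain_start[OF er] e(2) by auto
      have S: "f ` (R - set (e # r)) \<subseteq> V" using V(1) M(1) by blast
      have disj: "set p \<inter> set (e # r) = {}" using M(2) r(2) by blast
      have Mp: "set p \<union> set (e # r) \<union> (R - set (e # r)) = M" using M(1) r(2) by blast
      have ne': "f x \<noteq> h x" if "x \<in> set p \<union> set (e # r)" for x using that ne Mp by blast
      \<comment> \<open>If \<open>u\<close> is off the cycle through \<open>v\<close>, then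
        \<open>p\<close> can be prolonged by \<open>e\<close> to a path ending at
        \<open>h e\<close>. If \<open>u\<close> is on it, \<open>h e\<close> may be \<open>u\<close>
        and the prolonged walk would close; but then the remaining cycles avoid \<open>p\<close>
        altogether.\<close>
      show ?thesis
      proof (cases "u \<in> f ` set (e # r)")
        case True
        then have "f ` set p \<inter> f ` (R - set (e # r)) = {}" using R(2) r(5) by blast
        then have "\<exists>n\<le>2. (f, override_on f h (set p \<union> set (e # r) \<union> (R - set (e # r)))) \<in> walk_moves V X ^^ n"
          using Mp X
          by (intro common_cycle_moves[OF p r(1,3,4,5) _ disj ne' vV S]) simp_all
        then show ?thesis unfolding Mp .
      next
        case False
        have hp: "h e \<notin> f ` set p" using False he R(2) r(2) by blast
        have "e \<in> M" using e M(1) by blast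
        then have heV: "h e \<in> V" "v \<noteq> h e" using V ne e(2) by blast+
        have "\<exists>n\<le>2. (f, override_on f h (set (p @ [e]) \<union> set r \<union> (R - set (e # r)))) \<in> walk_moves V X ^^ n"
        proof (rule disjoint_cycles_moves[OF _ _ _ _ er _ _ r(4)])
          show "chain f h u (p @ [e]) (h e)" using p(1) e(2) by (auto simp: chain_append)
          show "distinct (map f (p @ [e]))" using p(2,3) e(2) by simp
          show "h e \<notin> f ` set (p @ [e])" using hp heV(2) e(2) by auto
          show "insert v (f ` set r) \<inter> f ` (R - set (e # r)) = {}" using r(5) e(2) by simp
          have "f ` set (p @ [e]) \<subseteq> f ` set p \<union> f ` set (e # r)" by auto
          then show "insert (h e) (f ` set (p @ [e])) \<inter> f ` (R - set (e # r)) \<subseteq> {u}"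
            using r(5) he R(2) by blast
          show "f x \<noteq> h x" if "x \<in> set (p @ [e]) \<union> set r" for x using that ne' by auto
          show "set (p @ [e]) \<union> set r \<union> (R - set (e # r)) \<subseteq> X" using X Mp by auto
          show "set (p @ [e]) \<inter> set r = {}" using disj r(3) by auto
          show "set (p @ [e]) \<inter> (R - set (e # r)) = {}" using M(2) by auto
        qed (use r(3) e(2) heV vV S in auto)
        moreover have "set (p @ [e]) \<union> set r \<union> (R - set (e # r)) = M" using Mp by auto
        ultimately show ?thesis by simp
      qed
    qed
  qed
qed

text \<open>With \<open>a = \<eta> i\<^sub>1\<close> and \<open>b = max (\<eta> i\<^sub>2) T\<close> for the number \<open>T\<close> of paths. A path lowers
  \<open>b\<close> if \<open>a < b\<close>, a walk through \<open>i\<close> lowers \<open>a\<close> if \<open>b < a\<close>, and a slice, which costs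
  two moves, lowers both if \<open>a = b\<close>.\<close>

lemma walk_moves_bound:
  fixes f h :: "'a \<Rightarrow> 'v"
  assumes fin: "finite V" "finite X" and h: "h ` X \<subseteq> V"
    and "f ` X \<subseteq> V" "{x. f x \<noteq> h x} \<subseteq> X"
    and "\<And>j. shared f h {x. f x \<noteq> h x} j \<le> a"
    and "\<And>j. j \<noteq> i \<Longrightarrow> shared f h {x. f x \<noteq> h x} j \<le> b"
    and "surplus V f h {x. f x \<noteq> h x} \<le> b"
  shows "\<exists>n\<le>a + b. (f, h) \<in> walk_moves V X ^^ n"
  using assms(4-)
proof (induction "a + b" arbitrary: a b f i rule: less_induct)
  case less
  define E where "E = {x. f x \<noteq> h x}"
  note V = less.prems(1) and EX = less.prems(2)[folded E_def]
  note sh_a = less.prems(3)[folded E_def] and sh_b = less.prems(4)[folded E_def]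
    and sur = less.prems(5)[folded E_def]
  have finE: "finite E" using EX fin(2) by (rule finite_subset)
  have ne: "f x \<noteq> h x" if "x \<in> E" for x using that by (simp add: E_def)
  have EV: "f ` E \<subseteq> V" "h ` E \<subseteq> V" using V h EX by blast+
  \<comment> \<open>Common pattern: \<open>M\<close> costs at most \<open>d\<close> moves, and the
    induction hypothesis takes over with bounds whose sum has dropped by at least \<open>d\<close>;
    the exceptional vertex may change to \<open>i'\<close>.\<close>
  have step: "\<exists>n\<le>a + b. (f, h) \<in> walk_moves V X ^^ n"
    if M: "M \<subseteq> E" and m: "\<exists>m\<le>d. (f, override_on f h M) \<in> walk_moves V X ^^ m"
      and le: "a' + b' + d \<le> a + b" "0 < d"
      and "\<And>j. shared f h (E - M) j \<le> a'" "\<And>j. j \<noteq> i' \<Longrightarrow> shared f h (E - M) j \<le> b'"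
      and "surplus V f h (E - M) \<le> b'"
    for M a' b' i' d
  proof -
    let ?g = "override_on f h M"
    have E': "{x. ?g x \<noteq> h x} = E - M" by (auto simp: E_def override_on_def)
    have "deg ?g (E - M) j = deg f (E - M) j" for j
      unfolding deg_def by (intro arg_cong[of _ _ card]) auto
    then have sh: "shared ?g h (E - M) j = shared f h (E - M) j"
      and su: "surplus V ?g h (E - M) = surplus V f h (E - M)" for j
      by (simp_all add: shared_def surplus_def)
    have "?g ` X \<subseteq> V" using V h by (auto simp: override_on_def)
    moreover have "{x. ?g x \<noteq> h x} \<subseteq> X" unfolding E' using EX by blast
    ultimately have "\<exists>n\<le>a' + b'. (?g, h) \<in> walk_moves V X ^^ n"
      using that(3-) by (intro less.hyps[of a' b' ?g i']) (simp_all add: E' sh su)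
    then obtain n where "n \<le> a' + b'" "(?g, h) \<in> walk_moves V X ^^ n" by blast
    moreover obtain m where "m \<le> d" "(f, ?g) \<in> walk_moves V X ^^ m" using m by blast
    ultimately show ?thesis using le relpow_trans by (intro exI[of _ "m + n"]) auto
  qed
  have walk_step: "\<exists>m\<le>1. (f, override_on f h (set xs)) \<in> walk_moves V X ^^ m"
    if "simple_walk f h u xs v" "set xs \<subseteq> E" for u xs v
  proof -
    have "xs \<noteq> []" "chain f h u xs v" using that(1) by (auto simp: simple_walk_def)
    then have "v \<in> V"
      using chain_last[of f h u xs v] that(2) EV(2) by (metis image_subset_iff last_in_set subsetD)
    then have "(override_on f h {}, override_on f h ({} \<union> set xs)) \<in> walk_moves V X"
      using that EX ne by (intro walk_move_override[OF that(1)]) auto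
    then show ?thesis by (intro exI[of _ 1]) simp
  qed
  consider "a < b" | "b < a" | "a = b" "a = 0" | "a = b" "0 < a" by linarith
  then show ?case
  proof cases
    case 1
    show ?thesis
    proof (cases "surplus V f h E = 0")
      \<comment> \<open>Shared degrees are at most \<open>a < b\<close> and there is no surplus, so
        \<open>b\<close> drops without a move.\<close>
      case True
      have "shared f h E j \<le> b - 1" for j using sh_a[of j] 1 by linarith
      then have "\<exists>n\<le>a + (b - 1). (f, h) \<in> walk_moves V X ^^ n"
        using 1 V EX sh_a True by (intro less.hyps[of a "b - 1" f i]) (simp_all add: E_def)
      then obtain n where "n \<le> a + (b - 1)" "(f, h) \<in> walk_moves V X ^^ n" by blast
      then show ?thesis by (intro exI[of _ n]) simp
    next
      case False
      then obtain u where u: "u \<in> V" "deg h E u < deg f E u"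
        unfolding surplus_def using fin(1) by (auto simp: sum_eq_0_iff)
      from draining_path[OF finE u(2)] obtain xs v where xs: "chain f h u xs v" "set xs \<subseteq> E"
        "distinct (map f xs)" "v \<notin> f ` set xs" "xs \<noteq> []" "u \<noteq> v" "deg f E v < deg h E v" .
      have sw: "simple_walk f h u xs v" using xs by (intro simple_walk_if_path)
      have bal: "balanced f h (set xs) u v" using sw by (rule simple_walk_balanced)
      have dr: "drains f h E u v" using u(2) xs(7) by (simp add: drains_def)
      have sh: "shared f h (E - set xs) j \<le> a" for j
        using shared_Diff[OF finE xs(2) bal dr, of j] sh_a[of j] by linarith
      show ?thesis
      proof (rule step[OF xs(2) walk_step[OF sw xs(2)], of a "b - 1"])
        show "surplus V f h (E - set xs) \<le> b - 1"
          using surplus_Diff_less[OF finE xs(2) bal dr fin(1) u(1) xs(6)] sur by linarith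
        show "shared f h (E - set xs) j \<le> b - 1" for j using sh[of j] 1 by linarith
      qed (use 1 sh in auto)
    qed
  next
    case 2
    show ?thesis
    proof (cases "shared f h E i = a")
      \<comment> \<open>No vertex attains \<open>a\<close>, so \<open>a\<close> drops without a
        move.\<close>
      case False
      have "shared f h E j \<le> a - 1" for j
        using False sh_a[of j] sh_b[of j] 2 by (cases "j = i") auto
      then have "\<exists>n\<le>a - 1 + b. (f, h) \<in> walk_moves V X ^^ n"
        using 2 V EX sh_b sur by (intro less.hyps[of "a - 1" b f i]) (simp_all add: E_def)
      then obtain n where "n \<le> a - 1 + b" "(f, h) \<in> walk_moves V X ^^ n" by blast
      then show ?thesis by (intro exI[of _ n]) simp
    next
      case True
      then have "0 < shared f h E i" using 2 by simp
      from walk_through[of E f h, OF finE ne this] obtain u xs v where sw: "simple_walk f h u xs v"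
        "set xs \<subseteq> E" and dr: "drains f h E u v" and pos: "0 < shared f h (set xs) i" by blast
      have bal: "balanced f h (set xs) u v" using sw(1) by (rule simple_walk_balanced)
      note sh = shared_Diff[OF finE sw(2) bal dr]
      show ?thesis
      proof (rule step[OF sw(2) walk_step[OF sw], of "a - 1" b i])
        show "shared f h (E - set xs) j \<le> a - 1" for j
          using sh[of j] sh_a[of j] sh_b[of j] pos 2 by (cases "j = i") auto
        show "shared f h (E - set xs) j \<le> b" if "j \<noteq> i" for j
          using sh[of j] sh_b[OF that] by linarith
        show "surplus V f h (E - set xs) \<le> b"
          using surplus_Diff_le[OF finE sw(2) bal dr, of V] sur by linarith
      qed (use 2 in auto)
    qed
  next
    \<comment> \<open>No surplus makes the outdegree the smaller one everywhere, so it is the shared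
      degree, which is zero; no arcs remain.\<close>
    case 3
    have "deg f E j \<le> deg h E j" if "j \<in> V" for j
      using sur 3 that fin(1) unfolding surplus_def by (auto simp: sum_eq_0_iff)
    then have "deg f E j = 0" if "j \<in> V" for j
      using sh_a[of j] 3(2) that unfolding shared_def by fastforce
    then have "card E = 0" using sum_deg[OF finE fin(1) EV(1)] by simp
    then have "f = h" using finE by (auto simp: E_def)
    then show ?thesis by (intro exI[of _ 0]) simp
  next
    case 4
    obtain M u v where M: "M \<subseteq> E" and bal: "balanced f h M u v" and dr: "drains f h E u v"
      and le: "\<And>j. shared f h M j \<le> 1" and one: "\<And>j. shared f h E j = a \<Longrightarrow> shared f h M j = 1"
      and uv: "surplus V f h E = a \<Longrightarrow> u \<noteq> v" "u \<noteq> v \<Longrightarrow> u \<in> V"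
      using max_degree_slice[OF finE fin(1) EV 4(2) sh_a] sur 4(1) by blast
    have finM: "finite M" using M finE by (rule finite_subset)
    have "\<exists>n\<le>2. (f, override_on f h M) \<in> walk_moves V X ^^ n"
      by (rule slice_moves[OF finM bal le]) (use ne M EV EX in blast)+
    moreover have "shared f h (E - M) j \<le> a - 1" for j
      using shared_Diff[OF finE M bal dr, of j] sh_a[of j] one[of j] by (cases "shared f h E j = a") auto
    moreover have "surplus V f h (E - M) \<le> a - 1"
    proof (cases "surplus V f h E = a")
      case True
      then show ?thesis
        using surplus_Diff_less[OF finE M bal dr fin(1) uv(2)[OF uv(1)] uv(1)] by simp
    next
      case False
      then show ?thesis using surplus_Diff_le[OF finE M bal dr, of V] sur 4(1) by linarith
    qed
    ultimately show ?thesis using 4 by (intro step[OF M, of 2 "a - 1" "a - 1"]) auto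
  qed
qed

section \<open>From assignments back to clusterings\<close>

definition clusters :: "nat \<Rightarrow> 'a set \<Rightarrow> ('a \<Rightarrow> nat) \<Rightarrow> 'a set list" where
  "clusters k X f = map (\<lambda>i. {x \<in> X. f x = i}) [0..<k]"

lemma nth_clusters: "i < k \<Longrightarrow> clusters k X f ! i = {x \<in> X. f x = i}"
  by (simp add: clusters_def)

lemma k_clustering_clusters:
  assumes "f ` X \<subseteq> {..<k}"
  shows "k_clustering k X (clusters k X f)"
  using assms unfolding k_clustering_def disjoint_family_on_def
  by (auto simp: nth_clusters) (simp add: clusters_def)

lemma arcs_cdg_clusters:
  assumes "f ` X \<subseteq> {..<k}" "g ` X \<subseteq> {..<k}"
  shows "arcs (cdg k (clusters k X f) (clusters k X g)) = (\<lambda>x. (f x, x, g x)) ` {x \<in> X. f x \<noteq> g x}"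
proof -
  have "f x < k" "g x < k" if "x \<in> X" for x using assms that by auto
  then show ?thesis by (auto simp: cdg_def nth_clusters)
qed

lemma cas_cdg:
  "pre_digraph.cas (cdg k A B) u (map (\<lambda>x. (f x, x, g x)) xs) v \<longleftrightarrow> chain f g u xs v"
  by (induction xs arbitrary: u) (auto simp: pre_digraph.cas.simps cdg_def)

lemma awalk_verts_cdg:
  assumes "chain f g u xs v"
  shows "pre_digraph.awalk_verts (cdg k A B) u (map (\<lambda>x. (f x, x, g x)) xs) = map f xs @ [v]"
  using assms by (induction xs arbitrary: u) (auto simp: pre_digraph.awalk_verts.simps cdg_def)

text \<open>The vertex list of the walk is \<open>map f xs @ [v]\<close>. For
  \<open>u \<noteq> v\<close>, \<open>simple_walk\<close> makes it distinct, as \<open>apath\<close>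
  demands; for \<open>u = v\<close> it does so after dropping the first vertex, as
  \<open>cycle\<close> demands.\<close>

lemma walk_move_clusters:
  assumes move: "(f, g) \<in> walk_moves {..<k} X" and f: "f ` X \<subseteq> {..<k}"
  shows "g ` X \<subseteq> {..<k}" "(clusters k X f, clusters k X g) \<in> moves k X"
proof -
  obtain u xs v where sw: "simple_walk f g u xs v" and v: "v < k"
    and xs: "{x. f x \<noteq> g x} = set xs" "set xs \<subseteq> X"
    using move by (auto simp: walk_moves_def)
  have ch: "chain f g u xs v" and dist: "distinct (map f xs)" and ne: "xs \<noteq> []"
    and vtl: "v \<notin> set (tl (map f xs))"
    using sw by (auto simp: simple_walk_def)
  have vts: "insert u (g ` set xs) = insert v (f ` set xs)"
    using chain_vertices[OF ch] by simp
  have "f ` set xs \<subseteq> {..<k}" using f xs(2) by blast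
  then have sub: "insert u (g ` set xs) \<subseteq> {..<k}" unfolding vts using v by simp
  show gX: "g ` X \<subseteq> {..<k}"
  proof
    fix y assume "y \<in> g ` X"
    then obtain x where x: "x \<in> X" "y = g x" by blast
    show "y \<in> {..<k}"
    proof (cases "x \<in> set xs")
      case True
      then show ?thesis using sub x(2) by blast
    next
      case False
      then have "f x = g x" using xs(1) by blast
      then show ?thesis using f x by (metis image_subset_iff)
    qed
  qed
  let ?G = "cdg k (clusters k X f) (clusters k X g)"
  let ?p = "map (\<lambda>x. (f x, x, g x)) xs"
  have "{x \<in> X. f x \<noteq> g x} = set xs" using xs by blast
  then have arcs: "set ?p = arcs ?G" using arcs_cdg_clusters[OF f gX] by simp
  have "u \<in> verts ?G" using sub by (simp add: cdg_def)
  then have aw: "pre_digraph.awalk ?G u ?p v"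
    using arcs ch by (simp add: pre_digraph.awalk_def cas_cdg)
  note kc = k_clustering_clusters[OF f] k_clustering_clusters[OF gX]
  show "(clusters k X f, clusters k X g) \<in> moves k X"
  proof (cases "u = v")
    case True
    have "distinct (tl (pre_digraph.awalk_verts ?G u ?p))"
      unfolding awalk_verts_cdg[OF ch] using dist vtl ne by (cases xs) auto
    then have "pre_digraph.cycle ?G ?p"
      unfolding pre_digraph.cycle_def using aw True ne by auto
    then show ?thesis using kc arcs unfolding moves_def cyclical_move_def by blast
  next
    case False
    then have "v \<notin> set (map f xs)" using vtl ne ch by (cases xs) auto
    then have "pre_digraph.apath ?G u ?p v"
      unfolding pre_digraph.apath_def awalk_verts_cdg[OF ch] using aw dist by simp
    moreover have "?p \<noteq> []" using ne by simp
    ultimately show ?thesis using kc arcs unfolding moves_def sequential_move_def by blast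
  qed
qed

lemma relpow_walk_moves_clusters:
  assumes "(f, g) \<in> walk_moves {..<k} X ^^ n" "f ` X \<subseteq> {..<k}"
  shows "(clusters k X f, clusters k X g) \<in> moves k X ^^ n"
proof -
  have "g ` X \<subseteq> {..<k} \<and> (clusters k X f, clusters k X g) \<in> moves k X ^^ n"
    using assms(1)
  proof (induction n arbitrary: g)
    case 0
    then show ?case using assms(2) by simp
  next
    case (Suc n)
    then obtain g' where g': "(f, g') \<in> walk_moves {..<k} X ^^ n" "(g', g) \<in> walk_moves {..<k} X"
      by auto
    then have IH: "g' ` X \<subseteq> {..<k}" "(clusters k X f, clusters k X g') \<in> moves k X ^^ n"
      using Suc.IH by blast+
    then show ?case using walk_move_clusters[OF g'(2) IH(1)] by auto
  qed
  then show ?thesis by blast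
qed

lemma k_clustering_assignment:
  assumes "k_clustering k X C" "0 < k"
  obtains f where "f ` X \<subseteq> {..<k}" "clusters k X f = C" "\<forall>x. x \<notin> X \<longrightarrow> f x = 0"
    "\<forall>i<k. C ! i = {x \<in> X. f x = i}"
proof -
  \<comment> \<open>The default 0 makes any two such assignments agree outside \<open>X\<close>, as
    \<open>walk_moves\<close> requires.\<close>
  define f where "f x = (if x \<in> X then (THE i. i < k \<and> x \<in> C ! i) else 0)" for x
  have f: "f x = i" if "i < k" "x \<in> C ! i" for x i
  proof -
    have "x \<in> X" using k_clustering_in_iff[OF assms(1)] that by blast
    moreover have "(THE i. i < k \<and> x \<in> C ! i) = i"
      using that k_clustering_unique[OF assms(1)] by (intro the_equality) blast+
    ultimately show ?thesis by (simp add: f_def)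
  qed
  have ex: "\<exists>i<k. x \<in> C ! i" if "x \<in> X" for x
    using k_clustering_in_iff[OF assms(1)] that by blast
  have range: "f ` X \<subseteq> {..<k}"
  proof
    fix y assume "y \<in> f ` X"
    then obtain x where "x \<in> X" "y = f x" by blast
    then show "y \<in> {..<k}" using ex[of x] f by auto
  qed
  have nth: "C ! i = {x \<in> X. f x = i}" if "i < k" for i
  proof (intro set_eqI iffI)
    fix x assume "x \<in> C ! i"
    then show "x \<in> {x \<in> X. f x = i}" using f[OF that] k_clustering_in_iff[OF assms(1)] that by blast
  next
    fix x assume "x \<in> {x \<in> X. f x = i}"
    then show "x \<in> C ! i" using ex[of x] f by auto
  qed
  have "clusters k X f = C"
    using assms(1) nth by (intro nth_equalityI) (simp_all add: clusters_def k_clustering_def)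
  moreover have "\<forall>x. x \<notin> X \<longrightarrow> f x = 0" by (simp add: f_def)
  ultimately show ?thesis using range nth that by blast
qed

lemma shared_degree_clusters:
  assumes "f ` X \<subseteq> {..<k}" "g ` X \<subseteq> {..<k}"
  shows "shared_degree (cdg k (clusters k X f) (clusters k X g)) i = shared f g {x \<in> X. f x \<noteq> g x} i"
proof -
  let ?E = "{x \<in> X. f x \<noteq> g x}" and ?G = "cdg k (clusters k X f) (clusters k X g)"
  let ?t = "\<lambda>x. (f x, x, g x)"
  have "in_arcs ?G i = ?t ` {x \<in> ?E. g x = i}" "out_arcs ?G i = ?t ` {x \<in> ?E. f x = i}"
    unfolding in_arcs_def out_arcs_def arcs_cdg_clusters[OF assms] by (auto simp: cdg_def)
  moreover have "card (?t ` A) = card A" for A by (rule card_image) (auto intro: inj_onI)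
  ultimately have "in_degree ?G i = deg g ?E i" "out_degree ?G i = deg f ?E i"
    by (simp_all only: in_degree_def out_degree_def deg_def)
  then show ?thesis by (simp only: shared_degree_def shared_def min.commute)
qed

theorem theorem3:
  fixes k i\<^sub>1 i\<^sub>2 :: nat and X :: "'a set" and C C' :: "'a set list"
    and \<delta> \<eta> :: "nat \<Rightarrow> nat"
  assumes "k \<ge> 2"
    and "finite X"
    and "k_clustering k X C"
    and "k_clustering k X C'"
    and "\<And>i. i < k \<Longrightarrow> int (\<delta> i) = \<bar>int (card (C ! i)) - int (card (C' ! i))\<bar>"
    and "\<And>i. i < k \<Longrightarrow> \<eta> i = shared_degree (cdg k C C') i"
    and "is_arg_max \<eta> (\<lambda>i. i < k) i\<^sub>1"
    and "is_arg_max \<eta> (\<lambda>i. i < k \<and> i \<noteq> i\<^sub>1) i\<^sub>2"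
  shows "real (transformation_distance k X C C')
    \<le> real (\<eta> i\<^sub>1) + max (real (\<eta> i\<^sub>2)) (1 / 2 * (\<Sum>i<k. real (\<delta> i)))"
proof -
  have k: "0 < k" using assms(1) by simp
  obtain f where f: "f ` X \<subseteq> {..<k}" "clusters k X f = C" "\<forall>x. x \<notin> X \<longrightarrow> f x = 0"
    "\<forall>i<k. C ! i = {x \<in> X. f x = i}"
    by (rule k_clustering_assignment[OF assms(3) k])
  obtain h where h: "h ` X \<subseteq> {..<k}" "clusters k X h = C'" "\<forall>x. x \<notin> X \<longrightarrow> h x = 0"
    "\<forall>i<k. C' ! i = {x \<in> X. h x = i}"
    by (rule k_clustering_assignment[OF assms(4) k])
  define E where "E = {x. f x \<noteq> h x}"
  have E: "E = {x \<in> X. f x \<noteq> h x}" using f(3) h(3) unfolding E_def by metis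
  have finE: "finite E" and EX: "E \<subseteq> X" using assms(2) by (auto simp: E)
  have EV: "f ` E \<subseteq> {..<k}" "h ` E \<subseteq> {..<k}" using f(1) h(1) EX by blast+
  have eta: "\<eta> i = shared f h E i" if "i < k" for i
    using assms(6)[OF that] shared_degree_clusters[OF f(1) h(1), of i]
    unfolding E f(2) h(2) by simp
  \<comment> \<open>\<open>walk_moves_bound\<close> asks for bounds at every natural number; from
    \<open>k\<close> on there are no edges.\<close>
  have out: "shared f h E i = 0" if "\<not> i < k" for i
  proof -
    have "i \<notin> f ` E" using EV(1) that by blast
    then show ?thesis using deg_pos_iff[OF finE, of f i] by (simp add: shared_def)
  qed
  have max1: "shared f h E i \<le> \<eta> i\<^sub>1" for i
    using assms(7) eta out by (cases "i < k") (auto simp: is_arg_max_linorder)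
  have max2: "shared f h E i \<le> \<eta> i\<^sub>2" if "i \<noteq> i\<^sub>1" for i
    using assms(8) that eta out by (cases "i < k") (auto simp: is_arg_max_linorder)
  define T where "T = surplus {..<k} f h E"
  have delta: "\<delta> i = (deg f E i - deg h E i) + (deg h E i - deg f E i)" if i: "i < k" for i
  proof -
    let ?S = "{x \<in> X. f x = i \<and> h x = i}"
    have "{x \<in> X. f x = i} = {x \<in> E. f x = i} \<union> ?S" "{x \<in> X. h x = i} = {x \<in> E. h x = i} \<union> ?S"
      unfolding E by auto
    moreover have "{x \<in> E. f x = i} \<inter> ?S = {}" "{x \<in> E. h x = i} \<inter> ?S = {}"
      unfolding E by auto
    ultimately have "card (C ! i) = deg f E i + card ?S" "card (C' ! i) = deg h E i + card ?S"
      using f(4) h(4) i finE assms(2) by (simp_all add: deg_def card_Un_disjoint)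
    then show ?thesis using assms(5)[OF i] by linarith
  qed
  have "(\<Sum>i<k. \<delta> i) = surplus {..<k} f h E + surplus {..<k} h f E"
    unfolding surplus_def sum.distrib[symmetric] using delta by (intro sum.cong) auto
  also have "\<dots> = 2 * T"
    using surplus_swap[OF finE finite_lessThan EV] by (simp add: T_def)
  finally have T: "1 / 2 * (\<Sum>i<k. real (\<delta> i)) = real T"
    unfolding of_nat_sum[symmetric] by simp
  have "\<exists>n\<le>\<eta> i\<^sub>1 + max (\<eta> i\<^sub>2) T. (f, h) \<in> walk_moves {..<k} X ^^ n"
    using max1 max2 EX
    by (intro walk_moves_bound[OF finite_lessThan assms(2) h(1) f(1), of _ i\<^sub>1])
      (auto simp: T_def simp flip: E_def intro: le_max_iff_disj[THEN iffD2])
  then obtain n where n: "n \<le> \<eta> i\<^sub>1 + max (\<eta> i\<^sub>2) T" "(f, h) \<in> walk_moves {..<k} X ^^ n"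
    by blast
  have "(C, C') \<in> moves k X ^^ n"
    using relpow_walk_moves_clusters[OF n(2) f(1)] unfolding f(2) h(2) .
  then have "transformation_distance k X C C' \<le> n"
    unfolding transformation_distance_def by (rule Least_le)
  then have "transformation_distance k X C C' \<le> \<eta> i\<^sub>1 + max (\<eta> i\<^sub>2) T" using n(1) by linarith
  then show ?thesis unfolding T by linarith
qed

end
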